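(* Let $n_1,n_2\ge1$ be integers, $n:=n_1n_2$, and let $R$ be an $n\times n$ complex Hermitian positive definite Toeplitz-block-Toeplitz matrix with $n_2\times n_2$ blocks, each of size $n_1\times n_1$. Then the application of the generalized reflection coefficient recurrences given in the context resumes in (is carried out by) the algorithm described in the context: the values $p_{k,l},q_{k,l},a_{k,l},a'_{k,l},v_{k,l},v'_{k,l}$ that the algorithm produces at the pairs $(k,l)$ to which it applies Subroutine 1 are those defined by the recurrences. The complexity of the algorithm is $O(n_1^3n_2^2)$.
   Context: All matrices and vectors are indexed from $0$; $R=\{r_{i,j}\}_{i,j=0,\dots,n-1}$. For integers $a\ge 0$, $b\ge1$: $a \operatorname{sec} b:=b\lfloor a/b\rfloor$ and $a\bmod b:=a-(a\operatorname{sec} b)$. The superscript $*$ is entrywise complex conjugation, $T$ is transpose without conjugation, $e_0,\dots,e_{n-1}$ is the canonical basis of $\mathbb C^n$. Toeplitz-block-Toeplitz: $r_{i,j}$ depends only on the pair $(\lfloor j/n_1\rfloor-\lfloor i/n_1\rfloor,\ (j\bmod n_1)-(i\bmod n_1))$. Recurrences: $p_{k,k}:=q_{k,k}:=e_k$ for $0\le k\le n-1$, and for $0\le k<l\le n-1$, by increasing $l-k$, $$a_{k,l}=\frac{p_{k,l-1}^T R\,e_l}{q_{k+1,l}^T R\,e_l},\quad a'_{k,l}=\frac{q_{k+1,l}^T R\,e_k}{p_{k,l-1}^T R\,e_k},\quad p_{k,l}=p_{k,l-1}-a_{k,l}q_{k+1,l},\quad q_{k,l}=q_{k+1,l}-a'_{k,l}p_{k,l-1};$$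 and $v_{k,l}:=q_{k,l}^TRe_l$, $v'_{k,l}:=p_{k,l}^TRe_k$, which satisfy $v_{k,l}=v_{k+1,l}(1-a_{k,l}a'_{k,l})$, $v'_{k,l}=v'_{k,l-1}(1-a_{k,l}a'_{k,l})$ and are positive reals. Notation: $(k\otimes l):=\big(k\operatorname{sec} n_1+n_1-1-(l\bmod n_1),\ l\operatorname{sec} n_1+n_1-1-(k\bmod n_1)\big)$. For a vector $w=[x_i]$ carrying indices $k\le l$, $\tilde w=[\tilde x_i]$ with $\tilde x_i=x_{l-i+k}$ for $k\le i\le l$ and $\tilde x_i=x_i$ otherwise. $U$ is the $n\times n$ matrix with ones on the first subdiagonal and zeros elsewhere. Subroutine 1 (applied to a pair $(k,l)$ with inputs $\hat p,\hat q,\hat v,\hat v'$): $$a_{k,l}=\frac{\hat p^TRe_l}{\hat v},\quad a'_{k,l}=\frac{\hat q^TRe_k}{\hat v'},\quad p_{k,l}=\hat p-a_{k,l}\hat q,\quad q_{k,l}=\hat q-a'_{k,l}\hat p,\quad v_{k,l}=\hat v(1-a_{k,l}a'_{k,l}),\quad v'_{k,l}=\hat v'(1-a_{k,l}a'_{k,l}).$$ Algorithm. Initialization: for $k=0,\dots,n_1-1$ set $p_{k,k}=q_{k,k}=e_k$, $v_{k,k}=v'_{k,k}=r_{0,0}$. Main routine: for $d_2=0,1,\dots,n_2-1$ do (A) and then (B). (A) Lower triangle loop; only if $d_2\ne0$. For $d_1=n_1-1$ down to $0$, for $u=0$ to $n_1-d_1-1$: set $k=u+d_1$, $l=d_2n_1+u$,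 $k'=k\operatorname{sec} n_1+n_1-1-(l\bmod n_1)$. If $k\le k'$: - if $u=0$, put $(\kappa,\lambda)=(k\otimes (l-1))$ and set $\hat p=U^{n_1-1}(\tilde q_{\kappa,\lambda})^*$, $\hat v'=v_{\kappa,\lambda}$; otherwise set $\hat p=p_{k,l-1}$, $\hat v'=v'_{k,l-1}$; - if $k=k'$, set $\hat q=U(\tilde{\hat p})^*$, $\hat v=\hat v'$, where $\hat p$ carries the indices $(k,l-1)$; otherwise set $\hat q=q_{k+1,l}$, $\hat v=v_{k+1,l}$; - apply Subroutine 1 to $(k,l)$. (B) Exclusively upper triangle loop. For $d_1=1$ to $n_1-1$, for $u=0$ to $n_1-d_1-1$: set $k=u$, $l=d_2n_1+u+d_1$, $k'=k\operatorname{sec} n_1+n_1-1-(l\bmod n_1)$. If $k\le k'$: - set $\hat p=p_{k,l-1}$, $\hat v'=v'_{k,l-1}$; - if $k=k'$, set $\hat q=U(\tilde{\hat p})^*$, $\hat v=\hat v'$, where $\hat p$ carries the indices $(k,l-1)$; otherwise set $\hat q=q_{k+1,l}$, $\hat v=v_{k+1,l}$; - apply Subroutine 1 to $(k,l)$.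
   Formalization: In step (A), case u=0, the printed shift U^{n_1-1} is replaced by U^k: as printed the algorithm gives wrong values whenever n_1,n_2≥2 (for n_1=n_2=2, R=I it yields p_{0,2}=e_1 instead of e_0); for n_1=1 or n_2=1 the two versions agree. *)

theory Defs
  imports
    "Jordan_Normal_Form.Schur_Decomposition"
    "HOL-Library.State_Monad"
begin

section \<open>Hermitian positive definite Toeplitz-block-Toeplitz matrices\<close>

definition hermitian :: "complex mat \<Rightarrow> bool" where
  "hermitian R \<longleftrightarrow> mat_adjoint R = R"

definition positive_definite :: "complex mat \<Rightarrow> bool" where
  "positive_definite R \<longleftrightarrow>
     (\<forall>x \<in> carrier_vec (dim_row R). x \<noteq> 0\<^sub>v (dim_row R) \<longrightarrow> 0 < Re ((R *\<^sub>v x) \<bullet>c x))"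

definition toeplitz_block_toeplitz :: "nat \<Rightarrow> nat \<Rightarrow> complex mat \<Rightarrow> bool" where
  "toeplitz_block_toeplitz n1 n2 R \<longleftrightarrow>
     R \<in> carrier_mat (n1 * n2) (n1 * n2) \<and>
     (\<exists>f :: int \<Rightarrow> int \<Rightarrow> complex. \<forall>i < n1 * n2. \<forall>j < n1 * n2.
        R $$ (i, j) = f (int (j div n1) - int (i div n1)) (int (j mod n1) - int (i mod n1)))"


section \<open>The recurrences\<close>

text \<open>All four families are total functions of the two indices; only the values for
  \<open>k \<le> l < n\<close> (\<open>k < l < n\<close> for the coefficients) are meaningful.\<close>

function rec_p rec_q :: "complex mat \<Rightarrow> nat \<Rightarrow> nat \<Rightarrow> complex vec"
  and rec_a rec_a' :: "complex mat \<Rightarrow> nat \<Rightarrow> nat \<Rightarrow> complex" where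
  "rec_p R k l =
     (if k < l then rec_p R k (l - 1) - rec_a R k l \<cdot>\<^sub>v rec_q R (k + 1) l
      else unit_vec (dim_row R) k)"
| "rec_q R k l =
     (if k < l then rec_q R (k + 1) l - rec_a' R k l \<cdot>\<^sub>v rec_p R k (l - 1)
      else unit_vec (dim_row R) k)"
| "rec_a R k l =
     (if k < l then (rec_p R k (l - 1) \<bullet> (R *\<^sub>v unit_vec (dim_row R) l)) /
                    (rec_q R (k + 1) l \<bullet> (R *\<^sub>v unit_vec (dim_row R) l))
      else 0)"
| "rec_a' R k l =
     (if k < l then (rec_q R (k + 1) l \<bullet> (R *\<^sub>v unit_vec (dim_row R) k)) /
                    (rec_p R k (l - 1) \<bullet> (R *\<^sub>v unit_vec (dim_row R) k))
      else 0)"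
  by pat_completeness auto
termination
  by (relation "measure (case_sum
        (case_sum (\<lambda>(R, k, l). 2 * (l - k) + 1) (\<lambda>(R, k, l). 2 * (l - k) + 1))
        (case_sum (\<lambda>(R, k, l). 2 * (l - k)) (\<lambda>(R, k, l). 2 * (l - k))))") auto

declare rec_p.simps [simp del] rec_q.simps [simp del]
  rec_a.simps [simp del] rec_a'.simps [simp del]

definition rec_v :: "complex mat \<Rightarrow> nat \<Rightarrow> nat \<Rightarrow> complex" where
  "rec_v R k l = rec_q R k l \<bullet> (R *\<^sub>v unit_vec (dim_row R) l)"

definition rec_v' :: "complex mat \<Rightarrow> nat \<Rightarrow> nat \<Rightarrow> complex" where
  "rec_v' R k l = rec_p R k l \<bullet> (R *\<^sub>v unit_vec (dim_row R) k)"


section \<open>Index transformation, reversal and shift\<close>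

definition sec_op :: "nat \<Rightarrow> nat \<Rightarrow> nat" (infixl "sec" 70) where
  "a sec b = b * (a div b)"

definition otimes :: "nat \<Rightarrow> nat \<Rightarrow> nat \<Rightarrow> nat \<times> nat" where
  "otimes n1 k l =
     (k sec n1 + n1 - 1 - (l mod n1), l sec n1 + n1 - 1 - (k mod n1))"

definition tilde :: "nat \<Rightarrow> nat \<Rightarrow> complex vec \<Rightarrow> complex vec" where
  "tilde k l x = vec (dim_vec x) (\<lambda>i. if k \<le> i \<and> i \<le> l then x $ (l - i + k) else x $ i)"

definition subdiag :: "nat \<Rightarrow> complex mat" where
  "subdiag n = mat n n (\<lambda>(i, j). if i = j + 1 then 1 else 0)"


section \<open>Machine model\<close>

text \<open>A program is a stateful computation on a memory holding one table per family.
  The field \<open>steps\<close> counts elementary operations; the field \<open>applied\<close> is a ghost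
  variable that records the index pairs to which Subroutine 1 has been applied.\<close>

record memory =
  mem_p :: "nat \<Rightarrow> nat \<Rightarrow> complex vec"
  mem_q :: "nat \<Rightarrow> nat \<Rightarrow> complex vec"
  mem_a :: "nat \<Rightarrow> nat \<Rightarrow> complex"
  mem_a' :: "nat \<Rightarrow> nat \<Rightarrow> complex"
  mem_v :: "nat \<Rightarrow> nat \<Rightarrow> complex"
  mem_v' :: "nat \<Rightarrow> nat \<Rightarrow> complex"
  applied :: "(nat \<times> nat) set"
  steps :: nat

type_synonym 'a prog = "(memory, 'a) state"

definition tick :: "unit prog" where
  "tick = State_Monad.update (\<lambda>M. M\<lparr>steps := steps M + 1\<rparr>)"

text \<open>\<open>charge x\<close> delivers \<open>x\<close> at unit cost. It is used only where \<open>x\<close> is the result of one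
  arithmetic operation on, or one copy of, complex numbers stored in scalars, in
  vector components or in entries of \<open>R\<close>.\<close>

definition charge :: "'a \<Rightarrow> 'a prog" where
  "charge x = do { tick; State_Monad.return x }"

text \<open>Access to one table cell; a cell of a vector table holds a reference.\<close>

definition load :: "(memory \<Rightarrow> nat \<Rightarrow> nat \<Rightarrow> 'a) \<Rightarrow> nat \<Rightarrow> nat \<Rightarrow> 'a prog" where
  "load tab k l = do { M \<leftarrow> State_Monad.get; charge (tab M k l) }"

definition store ::
  "(((nat \<Rightarrow> nat \<Rightarrow> 'a) \<Rightarrow> nat \<Rightarrow> nat \<Rightarrow> 'a) \<Rightarrow> memory \<Rightarrow> memory) \<Rightarrow> nat \<Rightarrow> nat \<Rightarrow> 'a \<Rightarrow> unit prog"
  where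
  "store upd k l x =
     do { tick; State_Monad.update (upd (\<lambda>f. f(k := (f k)(l := x)))) }"

text \<open>One step per iteration stands for the loop control and the bounded number of index
  computations and tests in the loop body.\<close>

fun for_each :: "'b list \<Rightarrow> ('b \<Rightarrow> unit prog) \<Rightarrow> unit prog" where
  "for_each [] body = State_Monad.return ()"
| "for_each (i # is) body = do { tick; body i; for_each is body }"

text \<open>Creation of a vector of length \<open>n\<close>, component by component.\<close>

definition make_vec :: "nat \<Rightarrow> (nat \<Rightarrow> complex prog) \<Rightarrow> complex vec prog" where
  "make_vec n f = do {
     xs \<leftarrow> State_Monad.traverse_list (\<lambda>i. do { tick; f i }) [0..<n];
     State_Monad.return (vec_of_list xs) }"

definition make_unit_vec :: "nat \<Rightarrow> nat \<Rightarrow> complex vec prog" where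
  "make_unit_vec n k = make_vec n (\<lambda>i. charge (if i = k then 1 else 0))"

fun column_product_upto :: "complex mat \<Rightarrow> complex vec \<Rightarrow> nat \<Rightarrow> nat \<Rightarrow> complex prog" where
  "column_product_upto R x l 0 = State_Monad.return 0"
| "column_product_upto R x l (Suc m) = do {
     s \<leftarrow> column_product_upto R x l m;
     t \<leftarrow> charge (x $ m * R $$ (m, l));
     charge (s + t) }"

definition column_product :: "complex mat \<Rightarrow> complex vec \<Rightarrow> nat \<Rightarrow> complex prog" where
  "column_product R x l = column_product_upto R x l (dim_row R)"

definition sub_scaled :: "nat \<Rightarrow> complex vec \<Rightarrow> complex \<Rightarrow> complex vec \<Rightarrow> complex vec prog" where
  "sub_scaled n x c y =
     make_vec n (\<lambda>i. do { t \<leftarrow> charge (c * y $ i); charge (x $ i - t) })"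

definition shifted_reversal ::
  "nat \<Rightarrow> nat \<Rightarrow> nat \<Rightarrow> nat \<Rightarrow> complex vec \<Rightarrow> complex vec prog" where
  "shifted_reversal n s k l x = do {
     y \<leftarrow> make_vec n (\<lambda>i. charge (if k \<le> i \<and> i \<le> l then x $ (l - i + k) else x $ i));
     z \<leftarrow> make_vec n (\<lambda>i. charge (cnj (y $ i)));
     make_vec n (\<lambda>i. charge (if s \<le> i then z $ (i - s) else 0)) }"


section \<open>The algorithm\<close>

definition subroutine1 ::
  "complex mat \<Rightarrow> nat \<Rightarrow> nat \<Rightarrow> complex vec \<Rightarrow> complex vec \<Rightarrow> complex \<Rightarrow> complex \<Rightarrow> unit prog"
  where
  "subroutine1 R k l ph qh vh vh' = do {
     s \<leftarrow> column_product R ph l;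
     a \<leftarrow> charge (s / vh);
     s' \<leftarrow> column_product R qh k;
     a' \<leftarrow> charge (s' / vh');
     p \<leftarrow> sub_scaled (dim_row R) ph a qh;
     q \<leftarrow> sub_scaled (dim_row R) qh a' ph;
     c \<leftarrow> charge (a * a');
     d \<leftarrow> charge (1 - c);
     v \<leftarrow> charge (vh * d);
     v' \<leftarrow> charge (vh' * d);
     store mem_a_update k l a;
     store mem_a'_update k l a';
     store mem_p_update k l p;
     store mem_q_update k l q;
     store mem_v_update k l v;
     store mem_v'_update k l v';
     State_Monad.update (applied_update (insert (k, l)))
   }"

definition initialization :: "nat \<Rightarrow> complex mat \<Rightarrow> unit prog" where
  "initialization n1 R = for_each [0..<n1] (\<lambda>k. do {
     e \<leftarrow> make_unit_vec (dim_row R) k;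
     store mem_p_update k k e;
     store mem_q_update k k e;
     r \<leftarrow> charge (R $$ (0, 0));
     store mem_v_update k k r;
     store mem_v'_update k k r
   })"

text \<open>The part common to both loops: the choice of \<open>\<hat>q\<close> and \<open>\<hat>v\<close>, followed by Subroutine 1.\<close>

definition finish_pair ::
  "complex mat \<Rightarrow> nat \<Rightarrow> nat \<Rightarrow> nat \<Rightarrow> complex vec \<Rightarrow> complex \<Rightarrow> unit prog" where
  "finish_pair R k k' l ph vh' = do {
     (qh, vh) \<leftarrow>
       (if k = k' then do {
          y \<leftarrow> shifted_reversal (dim_row R) 1 k (l - 1) ph;
          State_Monad.return (y, vh')
        } else do {
          y \<leftarrow> load mem_q (k + 1) l;
          w \<leftarrow> load mem_v (k + 1) l;
          State_Monad.return (y, w)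
        });
     subroutine1 R k l ph qh vh vh'
   }"

text \<open>For \<open>u = 0\<close> the vector \<open>p\<^bsub>k,l-1\<^esub>\<close> is obtained from \<open>q\<^bsub>k0,l0\<^esub>\<close>. Here \<open>k0 = 0\<close> and
  \<open>l0 = l - 1 - k\<close>, so that \<open>q\<^bsub>k0,l0\<^esub>\<close> is supported on \<open>{0..l-1-k}\<close> and has to be shifted by
  \<open>k\<close> to be supported on \<open>{k..l-1}\<close>. The exponent of the shift is therefore \<open>k\<close>; it equals
  \<open>n\<^sub>1 - 1\<close> only in the first round of the loop over \<open>d\<^sub>1\<close>, and a fixed exponent
  \<open>n\<^sub>1 - 1\<close> would give a wrong vector in the other rounds.\<close>

definition lower_triangle_loop :: "nat \<Rightarrow> complex mat \<Rightarrow> nat \<Rightarrow> unit prog" where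
  "lower_triangle_loop n1 R d2 =
     for_each (rev [0..<n1]) (\<lambda>d1. for_each [0..<n1 - d1] (\<lambda>u.
       let k = u + d1; l = d2 * n1 + u; k' = k sec n1 + n1 - 1 - (l mod n1) in
       if k \<le> k' then do {
         (ph, vh') \<leftarrow>
           (if u = 0 then
              let (k0, l0) = otimes n1 k (l - 1) in do {
                x \<leftarrow> load mem_q k0 l0;
                y \<leftarrow> shifted_reversal (dim_row R) k k0 l0 x;
                w \<leftarrow> load mem_v k0 l0;
                State_Monad.return (y, w)
              }
            else do {
              y \<leftarrow> load mem_p k (l - 1);
              w \<leftarrow> load mem_v' k (l - 1);
              State_Monad.return (y, w)
            });
         finish_pair R k k' l ph vh'
       } else State_Monad.return ()))"

definition upper_triangle_loop :: "nat \<Rightarrow> complex mat \<Rightarrow> nat \<Rightarrow> unit prog" where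
  "upper_triangle_loop n1 R d2 =
     for_each [1..<n1] (\<lambda>d1. for_each [0..<n1 - d1] (\<lambda>u.
       let k = u; l = d2 * n1 + u + d1; k' = k sec n1 + n1 - 1 - (l mod n1) in
       if k \<le> k' then do {
         ph \<leftarrow> load mem_p k (l - 1);
         vh' \<leftarrow> load mem_v' k (l - 1);
         finish_pair R k k' l ph vh'
       } else State_Monad.return ()))"

definition algorithm :: "nat \<Rightarrow> nat \<Rightarrow> complex mat \<Rightarrow> unit prog" where
  "algorithm n1 n2 R = do {
     initialization n1 R;
     for_each [0..<n2] (\<lambda>d2. do {
       (if d2 \<noteq> 0 then lower_triangle_loop n1 R d2 else State_Monad.return ());
       upper_triangle_loop n1 R d2
     })
   }"

text \<open>The initial contents of the tables are arbitrary, so a result that holds for every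
  fresh memory does not depend on cells that have not been written.\<close>

definition fresh :: "memory \<Rightarrow> bool" where
  "fresh M \<longleftrightarrow> applied M = {} \<and> steps M = 0"

definition final_memory :: "nat \<Rightarrow> nat \<Rightarrow> complex mat \<Rightarrow> memory \<Rightarrow> memory" where
  "final_memory n1 n2 R M = snd (run_state (algorithm n1 n2 R) M)"


section \<open>The vector programs in matrix notation\<close>

lemma run_charge: "run_state (charge x) M = (x, M\<lparr>steps := steps M + 1\<rparr>)"
  by (simp add: charge_def tick_def State_Monad.update_def)

lemma fst_traverse_list:
  assumes "\<And>i M. fst (run_state (f i) M) = g i"
  shows "fst (run_state (State_Monad.traverse_list f is) M) = map g is"
proof (induction "is" arbitrary: M)
  case Nil
  then show ?case by simp
next
  case (Cons i "is")
  show ?case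
    using Cons assms[of i M] by (auto split: prod.splits) (metis fst_conv)
qed

lemma fst_make_vec:
  assumes "\<And>i M. fst (run_state (f i) M) = g i"
  shows "fst (run_state (make_vec n f) M) = vec n g"
proof -
  have "fst (run_state (do { tick; f i }) M) = g i" for i M
    using assms by (simp add: tick_def State_Monad.update_def)
  from fst_traverse_list[where f = "\<lambda>i. do { tick; f i }", OF this]
  have "fst (run_state (State_Monad.traverse_list (\<lambda>i. do { tick; f i }) [0..<n]) M) = map g [0..<n]" .
  moreover have "vec_of_list (map g [0..<n]) = vec n g"
    by (intro eq_vecI) (auto simp: vec_of_list_index)
  ultimately show ?thesis
    by (auto simp: make_vec_def split: prod.splits)
qed

lemma fst_column_product:
  assumes "R \<in> carrier_mat n n" "x \<in> carrier_vec n" "l < n"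
  shows "fst (run_state (column_product R x l) M) = x \<bullet> (R *\<^sub>v unit_vec n l)"
proof -
  have upto: "fst (run_state (column_product_upto R x l m) M) = (\<Sum>i<m. x $ i * R $$ (i, l))" for m
  proof (induction m arbitrary: M)
    case (Suc m)
    then show ?case by (auto simp: run_charge split: prod.splits) (metis fst_conv)
  qed simp
  have "R *\<^sub>v unit_vec n l = col R l"
    using assms by (intro eq_vecI) auto
  then show ?thesis
    using assms by (simp add: column_product_def upto scalar_prod_def atLeast0LessThan)
qed

lemma fst_sub_scaled:
  assumes "x \<in> carrier_vec n" "y \<in> carrier_vec n"
  shows "fst (run_state (sub_scaled n x c y) M) = x - c \<cdot>\<^sub>v y"
proof -
  have "fst (run_state (sub_scaled n x c y) M) = vec n (\<lambda>i. x $ i - c * y $ i)"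
    unfolding sub_scaled_def by (rule fst_make_vec) (simp add: run_charge)
  also have "\<dots> = x - c \<cdot>\<^sub>v y"
    using assms by (intro eq_vecI) auto
  finally show ?thesis .
qed

lemma subdiag_pow:
  "subdiag n ^\<^sub>m s = mat n n (\<lambda>(i, j). if i = j + s then 1 else 0)"
proof (induction s)
  case 0
  then show ?case by (intro eq_matI) (auto simp: subdiag_def)
next
  case (Suc s)
  have "(\<Sum>h = 0..<n. (if i = h + s then 1 else 0) * (if h = j + 1 then 1 else 0))
      = (if i = j + Suc s then 1 else (0::complex))" if "i < n" "j < n" for i j
  proof -
    have "(\<Sum>h = 0..<n. (if i = h + s then 1 else 0) * (if h = j + 1 then 1 else 0))
        = (\<Sum>h = 0..<n. if h = j + 1 then (if i = j + Suc s then 1 else (0::complex)) else 0)"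
      by (intro sum.cong) auto
    also have "\<dots> = (if i = j + Suc s then 1 else 0)"
      using that by (subst sum.delta) auto
    finally show ?thesis .
  qed
  then show ?case
    unfolding pow_mat.simps Suc by (intro eq_matI) (auto simp: subdiag_def scalar_prod_def)
qed

lemma subdiag_pow_mult_vec:
  assumes "w \<in> carrier_vec n"
  shows "subdiag n ^\<^sub>m s *\<^sub>v w = vec n (\<lambda>i. if s \<le> i then w $ (i - s) else 0)"
proof (intro eq_vecI)
  fix i assume "i < dim_vec (vec n (\<lambda>i. if s \<le> i then w $ (i - s) else 0))"
  then have i: "i < n" by simp
  have "(subdiag n ^\<^sub>m s *\<^sub>v w) $ i = (\<Sum>h = 0..<n. (if i = h + s then 1 else 0) * w $ h)"
    using i assms by (simp add: subdiag_pow scalar_prod_def)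
  also have "\<dots> = (\<Sum>h = 0..<n. if h = i - s then (if s \<le> i then w $ (i - s) else 0) else 0)"
    by (intro sum.cong) auto
  also have "\<dots> = (if s \<le> i then w $ (i - s) else 0)"
    using i by (subst sum.delta) auto
  finally show "(subdiag n ^\<^sub>m s *\<^sub>v w) $ i = vec n (\<lambda>i. if s \<le> i then w $ (i - s) else 0) $ i"
    using i by simp
qed (simp add: subdiag_pow)

lemma fst_shifted_reversal:
  assumes "x \<in> carrier_vec n"
  shows "fst (run_state (shifted_reversal n s k l x) M) =
           subdiag n ^\<^sub>m s *\<^sub>v conjugate (tilde k l x)"
proof -
  have mk: "run_state (make_vec n (\<lambda>i. charge (g i))) M
      = (vec n g, snd (run_state (make_vec n (\<lambda>i. charge (g i))) M))" for g M
    by (metis fst_make_vec[of "\<lambda>i. charge (g i)" g] run_charge fst_conv prod.collapse)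
  let ?y = "vec n (\<lambda>i. if k \<le> i \<and> i \<le> l then x $ (l - i + k) else x $ i)"
  have y: "?y = tilde k l x"
    using assms by (auto simp: tilde_def)
  have z: "vec n (\<lambda>i. cnj (?y $ i)) = conjugate (tilde k l x)"
    unfolding y using assms by (intro eq_vecI) (auto simp: tilde_def)
  let ?z = "conjugate (tilde k l x)"
  have dim: "?z \<in> carrier_vec n"
    using assms by (auto simp: tilde_def)
  have "fst (run_state (shifted_reversal n s k l x) M) = vec n (\<lambda>i. if s \<le> i then ?z $ (i - s) else 0)"
    unfolding shifted_reversal_def State_Monad.run_state_bind
    by (subst mk, simp only: prod.case, subst mk, simp only: prod.case z, subst mk, simp)
  also have "\<dots> = subdiag n ^\<^sub>m s *\<^sub>v ?z"
    by (rule subdiag_pow_mult_vec[OF dim, symmetric])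
  finally show ?thesis .
qed

end

theory Submission
  imports Defs
begin

text \<open>By positive definiteness \<open>v\<^bsub>k,l\<^esub>\<close> and \<open>v'\<^bsub>k,l\<^esub>\<close> are values of the quadratic form
  of \<open>R\<close>, hence nonzero reals. If \<open>n\<^sub>1\<close> divides \<open>c + 1\<close>, the reflection \<open>i \<mapsto> c - i\<close> turns
  \<open>R\<close> into its transpose, which is its entrywise conjugate; so it turns the recurrence for
  \<open>p\<^bsub>k,l\<^esub>\<close> into the conjugate of the recurrence for \<open>q\<^bsub>c-l,c-k\<^esub>\<close>. The case \<open>c = k + l\<close> yields
  \<open>q\<^bsub>k+1,l\<^esub>\<close> from \<open>p\<^bsub>k,l-1\<^esub>\<close>, and the case \<open>c = l - 1\<close> yields \<open>p\<^bsub>k,l-1\<^esub>\<close> from \<open>q\<^bsub>0,l-1-k\<^esub>\<close>.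
  These are the two places where the algorithm departs from the recurrences. There are at most
  \<open>2 n\<^sub>1\<^sup>2 n\<^sub>2\<close> rounds of cost \<open>O(n\<^sub>1 n\<^sub>2)\<close>.\<close>

section \<open>Orthogonality and positivity\<close>

text \<open>The bilinear pairing x^T R e_l, without conjugation; the entries of \<open>R\<close>
  enter the recurrences only through it.\<close>

definition column_form :: "complex mat \<Rightarrow> complex vec \<Rightarrow> nat \<Rightarrow> complex" where
  "column_form R x l = x \<bullet> (R *\<^sub>v unit_vec (dim_row R) l)"

lemma column_form_sum:
  assumes "R \<in> carrier_mat n n" "x \<in> carrier_vec n" "l < n"
  shows "column_form R x l = (\<Sum>i<n. x $ i * R $$ (i, l))"
proof -
  have "R *\<^sub>v unit_vec n l = col R l"
    using assms by (intro eq_vecI) auto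
  then show ?thesis
    using assms by (simp add: column_form_def scalar_prod_def atLeast0LessThan)
qed

lemma column_form_sub_scaled:
  assumes "R \<in> carrier_mat n n" "x \<in> carrier_vec n" "y \<in> carrier_vec n" "l < n"
  shows "column_form R (x - c \<cdot>\<^sub>v y) l = column_form R x l - c * column_form R y l"
  using assms
  by (simp add: column_form_sum sum_subtractf[symmetric] sum_distrib_left algebra_simps)

section \<open>Support and normalization of the recurrence vectors\<close>

lemma rec_diag: "rec_p R k k = unit_vec (dim_row R) k" "rec_q R k k = unit_vec (dim_row R) k"
  by (simp_all add: rec_p.simps rec_q.simps)

lemma rec_step:
  assumes "k < l"
  shows "rec_p R k l = rec_p R k (l - 1) - rec_a R k l \<cdot>\<^sub>v rec_q R (k + 1) l"
    and "rec_q R k l = rec_q R (k + 1) l - rec_a' R k l \<cdot>\<^sub>v rec_p R k (l - 1)"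
    and "rec_a R k l = column_form R (rec_p R k (l - 1)) l / rec_v R (k + 1) l"
    and "rec_a' R k l = column_form R (rec_q R (k + 1) l) k / rec_v' R k (l - 1)"
  using assms by (simp_all add: rec_p.simps[of R k l] rec_q.simps[of R k l] rec_a.simps[of R k l]
      rec_a'.simps[of R k l] rec_v_def rec_v'_def column_form_def)

lemma rec_v_column_form:
  "rec_v R k l = column_form R (rec_q R k l) l" "rec_v' R k l = column_form R (rec_p R k l) k"
  by (simp_all add: rec_v_def rec_v'_def column_form_def)

text \<open>The induction runs over the gap \<open>d\<close>, because the recurrences express the
  pair (k, l) through (k, l - 1) and (k + 1, l), both of gap one less. The later inductions on the
  recurrences use the same scheme.\<close>

lemma rec_carrier_aux:
  "k + d = l \<Longrightarrow> rec_p R k l \<in> carrier_vec (dim_row R) \<and> rec_q R k l \<in> carrier_vec (dim_row R)"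
proof (induction d arbitrary: k l)
  case 0
  then show ?case by (simp add: rec_diag)
next
  case (Suc d)
  from Suc.IH[of k "l - 1"] Suc.IH[of "k + 1" l] Suc.prems show ?case
    by (auto simp: rec_step[of k l])
qed

lemma rec_carrier:
  assumes "k \<le> l"
  shows "rec_p R k l \<in> carrier_vec (dim_row R)" "rec_q R k l \<in> carrier_vec (dim_row R)"
  using rec_carrier_aux[of k "l - k" l R] assms by auto

lemma rec_index:
  assumes "k < l" "i < dim_row R"
  shows "rec_p R k l $ i = rec_p R k (l - 1) $ i - rec_a R k l * rec_q R (k + 1) l $ i"
    and "rec_q R k l $ i = rec_q R (k + 1) l $ i - rec_a' R k l * rec_p R k (l - 1) $ i"
proof -
  have "rec_p R k (l - 1) \<in> carrier_vec (dim_row R)" "rec_q R (k + 1) l \<in> carrier_vec (dim_row R)"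
    using assms by (auto intro!: rec_carrier)
  then show "rec_p R k l $ i = rec_p R k (l - 1) $ i - rec_a R k l * rec_q R (k + 1) l $ i"
    and "rec_q R k l $ i = rec_q R (k + 1) l $ i - rec_a' R k l * rec_p R k (l - 1) $ i"
    using assms by (auto simp: rec_step[of k l])
qed

lemma rec_support_aux:
  "k + d = l \<Longrightarrow> i < dim_row R \<Longrightarrow> i < k \<or> l < i \<Longrightarrow> rec_p R k l $ i = 0 \<and> rec_q R k l $ i = 0"
proof (induction d arbitrary: k l)
  case 0
  then show ?case by (auto simp: rec_diag unit_vec_def)
next
  case (Suc d)
  from Suc.IH[of k "l - 1"] Suc.IH[of "k + 1" l] Suc.prems show ?case
    by (auto simp: rec_index[of k l])
qed

lemma rec_support:
  assumes "k \<le> l" "i < dim_row R" "i < k \<or> l < i"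
  shows "rec_p R k l $ i = 0" "rec_q R k l $ i = 0"
  using rec_support_aux[of k "l - k" l i R] assms by auto

text \<open>\<open>rec_q R (k + 1) l\<close> vanishes at index k and
  \<open>rec_p R k (l - 1)\<close> at index l, so the subtractions leave these entries
  unchanged.\<close>

lemma rec_leading_aux:
  "k + d = l \<Longrightarrow> l < dim_row R \<Longrightarrow> rec_p R k l $ k = 1 \<and> rec_q R k l $ l = 1"
proof (induction d arbitrary: k l)
  case 0
  then show ?case by (auto simp: rec_diag)
next
  case (Suc d)
  from Suc.IH[of k "l - 1"] Suc.IH[of "k + 1" l] Suc.prems show ?case
    by (simp add: rec_index[of k l] rec_support)
qed

lemma rec_leading:
  assumes "k \<le> l" "l < dim_row R"
  shows "rec_p R k l $ k = 1" "rec_q R k l $ l = 1"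
  using rec_leading_aux[of k "l - k" l R] assms by auto

section \<open>The quadratic form of a Hermitian positive definite matrix\<close>

lemma hermitian_index:
  assumes "hermitian R" "R \<in> carrier_mat n n" "i < n" "j < n"
  shows "R $$ (j, i) = cnj (R $$ (i, j))"
proof -
  have "mat_adjoint R $$ (j, i) = cnj (R $$ (i, j))"
    using assms(2-4) by (simp add: mat_adjoint_def mat_of_rows_def)
  then show ?thesis
    using assms(1) by (simp add: hermitian_def)
qed

text \<open>The orthogonality makes \<open>column_form R x m\<close> the value of the quadratic form at the
  conjugate of \<open>x\<close>.\<close>

lemma leading_column_form:
  assumes R: "R \<in> carrier_mat n n" "hermitian R" "positive_definite R"
    and x: "x \<in> carrier_vec n" and m: "m < n" "x $ m = 1"
    and orth: "\<And>j. j < n \<Longrightarrow> j \<noteq> m \<Longrightarrow> x $ j \<noteq> 0 \<Longrightarrow> column_form R x j = 0"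
  shows "column_form R x m \<noteq> 0" "cnj (column_form R x m) = column_form R x m"
proof -
  \<comment> \<open>Summed by columns, only the term j = m survives by \<open>orth\<close>, with
    weight \<open>cnj (x $ m)\<close> = 1.\<close>
  let ?S = "\<Sum>j<n. \<Sum>i<n. x $ i * R $$ (i, j) * cnj (x $ j)"
  have "?S = (\<Sum>j<n. column_form R x j * cnj (x $ j))"
    using R x by (simp add: column_form_sum sum_distrib_right)
  also have "\<dots> = (\<Sum>j<n. if j = m then column_form R x m else 0)"
    using orth m by (intro sum.cong) auto
  also have "\<dots> = column_form R x m"
    using m by simp
  finally have S: "?S = column_form R x m" .
  \<comment> \<open>By Hermitian symmetry, conjugation exchanges the roles of i and j, so the sum is
    its own conjugate.\<close>
  have "cnj ?S = (\<Sum>j<n. \<Sum>i<n. cnj (x $ i) * R $$ (j, i) * x $ j)"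
    unfolding cnj_sum
    by (intro sum.cong refl) (simp add: hermitian_index[OF R(2,1), symmetric] del: One_nat_def)
  also have "\<dots> = (\<Sum>i<n. \<Sum>j<n. cnj (x $ i) * R $$ (j, i) * x $ j)"
    by (rule sum.swap)
  also have "\<dots> = ?S"
    by (simp add: mult_ac)
  finally show "cnj (column_form R x m) = column_form R x m"
    by (simp add: S)
  have "conjugate x \<noteq> 0\<^sub>v n"
  proof
    assume "conjugate x = 0\<^sub>v n"
    then have "conjugate x $ m = 0" using m by simp
    then show False using m x by simp
  qed
  then have "0 < Re ((R *\<^sub>v conjugate x) \<bullet>c conjugate x)"
    using R(1,3) x carrier_vec_conjugate[OF x] unfolding positive_definite_def by (metis carrier_matD(1))
  also have "(R *\<^sub>v conjugate x) \<bullet>c conjugate x = (\<Sum>i<n. \<Sum>j<n. x $ i * R $$ (i, j) * cnj (x $ j))"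
    using R x by (simp add: scalar_prod_def atLeast0LessThan sum_distrib_left sum_distrib_right mult_ac)
  also have "\<dots> = ?S"
    by (rule sum.swap)
  finally show "column_form R x m \<noteq> 0"
    by (auto simp: S)
qed

section \<open>Orthogonality relations and nonzero denominators\<close>

context
  fixes R :: "complex mat" and n :: nat
  assumes R: "R \<in> carrier_mat n n" "hermitian R" "positive_definite R"
begin

lemma column_form_rec_step:
  assumes "k < l" "l < n" "j < n"
  shows "column_form R (rec_p R k l) j =
           column_form R (rec_p R k (l - 1)) j - rec_a R k l * column_form R (rec_q R (k + 1) l) j"
    and "column_form R (rec_q R k l) j =
           column_form R (rec_q R (k + 1) l) j - rec_a' R k l * column_form R (rec_p R k (l - 1)) j"
proof -
  have "rec_p R k (l - 1) \<in> carrier_vec n" "rec_q R (k + 1) l \<in> carrier_vec n"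
    using assms R rec_carrier[of k "l - 1" R] rec_carrier[of "k + 1" l R] by auto
  with assms R show "column_form R (rec_p R k l) j =
           column_form R (rec_p R k (l - 1)) j - rec_a R k l * column_form R (rec_q R (k + 1) l) j"
    and "column_form R (rec_q R k l) j =
           column_form R (rec_q R (k + 1) l) j - rec_a' R k l * column_form R (rec_p R k (l - 1)) j"
    by (simp_all only: rec_step[of k l] column_form_sub_scaled)
qed

text \<open>Orthogonality and support leave a single column in the quadratic form. Orthogonality is
  assumed here because its inductive proof must already know that the denominators of the previous
  gap do not vanish.\<close>

lemma rec_v_nonzero_real_if_orthogonal:
  assumes "k \<le> l" "l < n"
    and "\<forall>j. k < j \<and> j \<le> l \<longrightarrow> column_form R (rec_p R k l) j = 0"
    and "\<forall>j. k \<le> j \<and> j < l \<longrightarrow> column_form R (rec_q R k l) j = 0"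
  shows "rec_v R k l \<noteq> 0 \<and> rec_v' R k l \<noteq> 0 \<and>
    cnj (rec_v R k l) = rec_v R k l \<and> cnj (rec_v' R k l) = rec_v' R k l"
proof -
  have dim: "dim_row R = n" using R by simp
  have "column_form R (rec_p R k l) j = 0" if "j < n" "j \<noteq> k" "rec_p R k l $ j \<noteq> 0" for j
    using that assms rec_support[of k l j R] dim by (cases "k \<le> j \<and> j \<le> l") auto
  moreover have "column_form R (rec_q R k l) j = 0" if "j < n" "j \<noteq> l" "rec_q R k l $ j \<noteq> 0" for j
    using that assms rec_support[of k l j R] dim by (cases "k \<le> j \<and> j \<le> l") auto
  ultimately show ?thesis
    unfolding rec_v_column_form
    using leading_column_form[OF R, of "rec_q R k l" l] leading_column_form[OF R, of "rec_p R k l" k]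
      rec_carrier[of k l R] rec_leading[of k l R] assms(1,2) dim by auto
qed

text \<open>Both predecessors are orthogonal to the columns strictly between k and l;
  \<open>rec_a R k l\<close> is chosen to cancel column l, and \<open>rec_a' R k l\<close> to cancel
  column k.\<close>

lemma rec_orthogonal_aux:
  "k + d = l \<Longrightarrow> l < n \<Longrightarrow>
    (\<forall>j. k < j \<and> j \<le> l \<longrightarrow> column_form R (rec_p R k l) j = 0) \<and>
    (\<forall>j. k \<le> j \<and> j < l \<longrightarrow> column_form R (rec_q R k l) j = 0)"
proof (induction d arbitrary: k l)
  case 0
  then show ?case by auto
next
  case (Suc d)
  have kl: "k < l" "k \<le> l - 1" "k + 1 \<le> l" "l - 1 < n" using Suc.prems by auto
  note IH = Suc.IH[of k "l - 1"] Suc.IH[of "k + 1" l]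
  have "rec_v R (k + 1) l \<noteq> 0" "rec_v' R k (l - 1) \<noteq> 0"
    using rec_v_nonzero_real_if_orthogonal[of k "l - 1"] rec_v_nonzero_real_if_orthogonal[of "k + 1" l]
      IH Suc.prems kl by auto
  then have a: "rec_a R k l * column_form R (rec_q R (k + 1) l) l = column_form R (rec_p R k (l - 1)) l"
    "rec_a' R k l * column_form R (rec_p R k (l - 1)) k = column_form R (rec_q R (k + 1) l) k"
    using kl by (simp_all add: rec_step(3,4)[of k l] rec_v_column_form)
  have "column_form R (rec_p R k l) j = 0" if j: "k < j" "j \<le> l" for j
  proof (cases "j = l")
    case True
    then show ?thesis using a kl Suc.prems by (simp add: column_form_rec_step(1)[of k l])
  next
    case False
    then show ?thesis using IH j kl Suc.prems by (simp add: column_form_rec_step(1)[of k l])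
  qed
  moreover have "column_form R (rec_q R k l) j = 0" if j: "k \<le> j" "j < l" for j
  proof (cases "j = k")
    case True
    then show ?thesis using a kl Suc.prems by (simp add: column_form_rec_step(2)[of k l])
  next
    case False
    then show ?thesis using IH j kl Suc.prems by (simp add: column_form_rec_step(2)[of k l])
  qed
  ultimately show ?case by blast
qed

lemma rec_v_nonzero_real:
  assumes "k \<le> l" "l < n"
  shows "rec_v R k l \<noteq> 0" "rec_v' R k l \<noteq> 0"
    "cnj (rec_v R k l) = rec_v R k l" "cnj (rec_v' R k l) = rec_v' R k l"
  using rec_v_nonzero_real_if_orthogonal[of k l] rec_orthogonal_aux[of k "l - k" l] assms by auto

text \<open>Pairing \<open>rec_q R k l\<close> with column l subtracts \<open>rec_a' R k l\<close>
  times the numerator of \<open>rec_a R k l\<close>, and that numerator is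
  \<open>rec_a R k l\<close> times \<open>rec_v R (k + 1) l\<close>. The second claim is symmetric.
  These are the scalar updates of Subroutine 1.\<close>

lemma rec_v_step:
  assumes "k < l" "l < n"
  shows "rec_v R k l = rec_v R (k + 1) l * (1 - rec_a R k l * rec_a' R k l)"
    and "rec_v' R k l = rec_v' R k (l - 1) * (1 - rec_a R k l * rec_a' R k l)"
proof -
  have nz: "rec_v R (k + 1) l \<noteq> 0" "rec_v' R k (l - 1) \<noteq> 0"
    using assms rec_v_nonzero_real(1)[of "k + 1" l] rec_v_nonzero_real(2)[of k "l - 1"] by auto
  then have a: "rec_a R k l * rec_v R (k + 1) l = column_form R (rec_p R k (l - 1)) l"
    "rec_a' R k l * rec_v' R k (l - 1) = column_form R (rec_q R (k + 1) l) k"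
    using assms by (simp_all add: rec_step(3,4)[of k l])
  have "rec_v R k l = rec_v R (k + 1) l - rec_a' R k l * column_form R (rec_p R k (l - 1)) l"
    using assms by (simp add: rec_v_column_form column_form_rec_step(2)[of k l])
  then show "rec_v R k l = rec_v R (k + 1) l * (1 - rec_a R k l * rec_a' R k l)"
    unfolding a(1)[symmetric] by (simp add: algebra_simps)
  have "rec_v' R k l = rec_v' R k (l - 1) - rec_a R k l * column_form R (rec_q R (k + 1) l) k"
    using assms by (simp add: rec_v_column_form column_form_rec_step(1)[of k l])
  then show "rec_v' R k l = rec_v' R k (l - 1) * (1 - rec_a R k l * rec_a' R k l)"
    unfolding a(2)[symmetric] by (simp add: algebra_simps)
qed

end

section \<open>Reflections\<close>

text \<open>Since c = m n1 - 1 is the last index of its block, its inner index is n1 - 1, and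
  subtracting i never borrows across blocks.\<close>

lemma div_mod_reflection:
  fixes i c n1 m :: nat
  assumes "c + 1 = m * n1" "i \<le> c"
  shows "(c - i) div n1 = m - 1 - i div n1" "i div n1 < m" "(c - i) mod n1 = n1 - 1 - i mod n1"
    "i mod n1 < n1"
proof -
  have n1: "0 < n1" using assms(1) by (cases n1) auto
  show lt: "i div n1 < m"
    using assms n1 by (simp add: div_less_iff_less_mult)
  show lt1: "i mod n1 < n1" using n1 by simp
  obtain r where r: "m = i div n1 + r + 1" 
    using lt by (metis less_iff_Suc_add Suc_eq_plus1)
  have "c - i = r * n1 + (n1 - 1 - i mod n1)"
  proof -
    have "c + 1 = i div n1 * n1 + r * n1 + n1" using assms(1) r by (simp add: algebra_simps)
    moreover have "i = i div n1 * n1 + i mod n1" by simp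
    ultimately show ?thesis using lt1 assms(2) by linarith
  qed
  then show "(c - i) div n1 = m - 1 - i div n1" "(c - i) mod n1 = n1 - 1 - i mod n1"
    using n1 r by simp_all
qed

text \<open>Reflections \<open>i \<mapsto> c - i\<close> with \<open>n\<^sub>1 dvd c + 1\<close> reverse block indices and indices within
  a block at the same time.\<close>

lemma toeplitz_block_toeplitz_reflection:
  assumes "toeplitz_block_toeplitz n1 n2 R" "c + 1 = m * n1"
    and "i \<le> c" "j \<le> c" "i < n1 * n2" "j < n1 * n2" "c - i < n1 * n2" "c - j < n1 * n2"
  shows "R $$ (c - i, c - j) = R $$ (j, i)"
proof -
  obtain f where f: "\<And>i j. i < n1 * n2 \<Longrightarrow> j < n1 * n2 \<Longrightarrow>
      R $$ (i, j) = f (int (j div n1) - int (i div n1)) (int (j mod n1) - int (i mod n1))"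
    using assms(1) by (auto simp: toeplitz_block_toeplitz_def)
  note r = div_mod_reflection[OF assms(2) assms(3)] div_mod_reflection[OF assms(2) assms(4)]
  \<comment> \<open>Reflection negates both index differences, just as transposition does. The
    bounds on quotients and remainders rule out truncated subtraction.\<close>
  have "int ((c - j) div n1) - int ((c - i) div n1) = int (i div n1) - int (j div n1)"
    "int ((c - j) mod n1) - int ((c - i) mod n1) = int (i mod n1) - int (j mod n1)"
    unfolding r(1,3,5,7) using r(2,4,6,8) by linarith+
  with assms f show ?thesis by simp
qed

text \<open>Both index differences are zero on the diagonal. This justifies the initial value
  \<open>R $$ (0, 0)\<close>.\<close>

lemma toeplitz_block_toeplitz_diag:
  assumes "toeplitz_block_toeplitz n1 n2 R" "i < n1 * n2"
  shows "R $$ (i, i) = R $$ (0, 0)"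
proof -
  have "0 < n1 * n2" using assms(2) by linarith
  then show ?thesis
    using assms unfolding toeplitz_block_toeplitz_def by fastforce
qed

section \<open>Reflection of the recurrences\<close>

context
  fixes R :: "complex mat" and n1 n2 n :: nat
  assumes R: "R \<in> carrier_mat n n" "hermitian R" and n: "n = n1 * n2"
    and tbt: "toeplitz_block_toeplitz n1 n2 R"
begin

text \<open>Reindexing by i to c - i carries the window k..l onto c-l..c-k and replaces
  \<open>R\<close> by its conjugate. Off their windows both vectors vanish, so only indices whose
  reflection stays in range matter.\<close>

lemma column_form_reflection:
  assumes c: "c + 1 = m * n1" and xy: "x \<in> carrier_vec n" "y \<in> carrier_vec n"
    and kl: "k \<le> l" "l \<le> c" "l < n" "c - k < n" "k \<le> j" "j \<le> l"
    and supp: "\<And>i. i < n \<Longrightarrow> i < k \<or> l < i \<Longrightarrow> x $ i = 0"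
      "\<And>i. i < n \<Longrightarrow> i < c - l \<or> c - k < i \<Longrightarrow> y $ i = 0"
    and refl: "\<And>i. k \<le> i \<Longrightarrow> i \<le> l \<Longrightarrow> x $ i = cnj (y $ (c - i))"
  shows "column_form R x j = cnj (column_form R y (c - j))"
proof -
  have "column_form R x j = (\<Sum>i\<in>{k..l}. x $ i * R $$ (i, j))"
    unfolding column_form_sum[OF R(1) xy(1) le_less_trans[OF kl(6,3)]]
    using kl supp(1) by (intro sum.mono_neutral_right) auto
  also have "\<dots> = (\<Sum>i\<in>{c-l..c-k}. cnj (y $ i * R $$ (i, c - j)))"
  proof (rule sum.reindex_bij_witness[where i = "\<lambda>i. c - i" and j = "\<lambda>i. c - i"])
    fix i assume i: "i \<in> {k..l}"
    have "R $$ (c - i, c - j) = R $$ (j, i)"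
      using i kl n by (intro toeplitz_block_toeplitz_reflection[OF tbt c]) auto
    also have "\<dots> = cnj (R $$ (i, j))"
      using i kl by (intro hermitian_index[OF R(2,1)]) auto
    finally show "cnj (y $ (c - i) * R $$ (c - i, c - j)) = x $ i * R $$ (i, j)"
      using refl[of i] i by simp
  qed (use kl in auto)
  also have "\<dots> = cnj (\<Sum>i\<in>{c-l..c-k}. y $ i * R $$ (i, c - j))"
    by simp
  also have "(\<Sum>i\<in>{c-l..c-k}. y $ i * R $$ (i, c - j)) = (\<Sum>i<n. y $ i * R $$ (i, c - j))"
    using kl supp(2) by (intro sum.mono_neutral_left) auto
  also have "\<dots> = column_form R y (c - j)"
    using kl column_form_sum[OF R(1) xy(2), of "c - j"] by simp
  finally show ?thesis .
qed

text \<open>The statement for p suffices for the induction: the one for q is the induction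
  hypothesis at the reflected pair, because the reflection is an involution that preserves the
  gap.\<close>

lemma rec_reflection_aux:
  assumes c: "c + 1 = m * n1"
  shows "k + d = l \<Longrightarrow> l \<le> c \<Longrightarrow> l < n \<Longrightarrow> c - k < n \<Longrightarrow> k \<le> i \<Longrightarrow> i \<le> l \<Longrightarrow>
    rec_p R k l $ i = cnj (rec_q R (c - l) (c - k) $ (c - i))"
proof (induction d arbitrary: k l i)
  case 0
  then show ?case using R by (simp add: rec_diag)
next
  case (Suc d)
  have dim: "dim_row R = n" using R by simp
  have kl: "k < l" "c - l < c - k"
    and refl: "c - (l - 1) = c - l + 1" "c - (c - l) = l" "c - (c - k - 1) = k + 1"
    using Suc.prems by auto
  \<comment> \<open>The window is enlarged by the index l, where both sides vanish by support, so
    that p and q are compared on the same window k..l.\<close>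
  have 1: "rec_p R k (l - 1) $ i = cnj (rec_q R (c - l + 1) (c - k) $ (c - i))"
    if "k \<le> i" "i \<le> l" for i
  proof (cases "i = l")
    case True
    then show ?thesis using kl Suc.prems dim by (simp add: rec_support)
  next
    case False
    have "rec_p R k (l - 1) $ i = cnj (rec_q R (c - (l - 1)) (c - k) $ (c - i))"
      by (rule Suc.IH) (use False Suc.prems that in auto)
    then show ?thesis by (simp only: refl)
  qed
  have 2: "rec_q R (k + 1) l $ i = cnj (rec_p R (c - l) (c - k - 1) $ (c - i))"
    if "k \<le> i" "i \<le> l" for i
  proof (cases "i = k")
    case True
    then show ?thesis using kl Suc.prems dim by (simp add: rec_support)
  next
    case False
    \<comment> \<open>The hypothesis is taken at (c - l, c - k - 1) and index c - i, then reflected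
      back.\<close>
    have "rec_p R (c - l) (c - k - 1) $ (c - i) =
        cnj (rec_q R (c - (c - k - 1)) (c - (c - l)) $ (c - (c - i)))"
      by (rule Suc.IH) (use False Suc.prems that in auto)
    moreover have "c - (c - i) = i" using that Suc.prems by simp
    ultimately show ?thesis by (simp only: refl complex_cnj_cnj)
  qed
  have carr: "rec_p R k (l - 1) \<in> carrier_vec n" "rec_q R (k + 1) l \<in> carrier_vec n"
    "rec_q R (c - l + 1) (c - k) \<in> carrier_vec n" "rec_p R (c - l) (c - k - 1) \<in> carrier_vec n"
    using kl Suc.prems rec_carrier(1)[of k "l - 1" R] rec_carrier(2)[of "k + 1" l R]
      rec_carrier(2)[of "c - l + 1" "c - k" R] rec_carrier(1)[of "c - l" "c - k - 1" R]
    unfolding dim by simp_all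
  have p: "column_form R (rec_p R k (l - 1)) l =
      cnj (column_form R (rec_q R (c - l + 1) (c - k)) (c - l))"
    by (rule column_form_reflection[OF c, where k = k and l = l])
      (use carr kl Suc.prems dim 1 in \<open>auto simp: rec_support\<close>)
  have q: "column_form R (rec_q R (k + 1) l) l =
      cnj (column_form R (rec_p R (c - l) (c - k - 1)) (c - l))"
    by (rule column_form_reflection[OF c, where k = k and l = l])
      (use carr kl Suc.prems dim 2 in \<open>auto simp: rec_support\<close>)
  \<comment> \<open>Numerator and denominator are the conjugates of those of
    \<open>rec_a' R (c - l) (c - k)\<close>.\<close>
  have a: "rec_a R k l = cnj (rec_a' R (c - l) (c - k))"
    unfolding rec_step(3)[OF kl(1)] rec_step(4)[OF kl(2)] rec_v_column_form p q by simp
  have "i < dim_row R" "c - i < dim_row R" using Suc.prems dim by auto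
  then show ?case
    using rec_index(1)[OF kl(1), of i R] rec_index(2)[OF kl(2), of "c - i" R] 1[of i] 2[of i] a Suc.prems
    by simp
qed

lemma rec_reflection:
  assumes "c + 1 = m * n1" "k \<le> l" "l \<le> c" "l < n" "c - k < n"
  shows "k \<le> i \<Longrightarrow> i \<le> l \<Longrightarrow> rec_p R k l $ i = cnj (rec_q R (c - l) (c - k) $ (c - i))"
    and "rec_v' R k l = cnj (rec_v R (c - l) (c - k))"
proof -
  show *: "rec_p R k l $ i = cnj (rec_q R (c - l) (c - k) $ (c - i))" if "k \<le> i" "i \<le> l" for i
    using rec_reflection_aux[OF assms(1), of k "l - k" l i] assms that by simp
  have dim: "dim_row R = n" using R by simp
  show "rec_v' R k l = cnj (rec_v R (c - l) (c - k))"
    unfolding rec_v_column_form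
    by (rule column_form_reflection[OF assms(1), where k = k and l = l])
      (use assms dim * rec_carrier[of k l R] rec_carrier[of "c - l" "c - k" R] in \<open>auto simp: rec_support\<close>)
qed

end


section \<open>Cost and weakest preconditions\<close>

text \<open>One notion serves two ends: it bounds the running time, and it ensures that all tables
  survive the computation of a vector.\<close>

definition quiet :: "'a prog \<Rightarrow> nat \<Rightarrow> bool" where
  "quiet m c \<longleftrightarrow> (\<forall>M. \<exists>t\<le>c. snd (run_state m M) = M\<lparr>steps := steps M + t\<rparr>)"

definition cost :: "'a prog \<Rightarrow> nat \<Rightarrow> bool" where
  "cost m c \<longleftrightarrow> (\<forall>M. steps (snd (run_state m M)) \<le> steps M + c)"

definition post :: "'a prog \<Rightarrow> memory \<Rightarrow> ('a \<Rightarrow> memory \<Rightarrow> bool) \<Rightarrow> bool" where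
  "post m M Q \<longleftrightarrow> Q (fst (run_state m M)) (snd (run_state m M))"

lemma quiet_mono: "quiet m c \<Longrightarrow> c \<le> d \<Longrightarrow> quiet m d"
  unfolding quiet_def by (meson order_trans)

lemma quiet_return: "quiet (State_Monad.return x) 0"
  by (simp add: quiet_def)

lemma quiet_tick: "quiet tick 1"
  by (auto simp: quiet_def tick_def State_Monad.update_def)

lemma quiet_charge: "quiet (charge x) 1"
  by (auto simp: quiet_def run_charge)

lemma quiet_load: "quiet (load tab k l) 1"
  by (auto simp: quiet_def load_def run_charge)

lemma quiet_bind:
  assumes "quiet m a" "\<And>x. quiet (f x) b"
  shows "quiet (State_Monad.bind m f) (a + b)"
  unfolding quiet_def
proof
  fix M
  obtain x M' where M': "run_state m M = (x, M')" by fastforce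
  obtain s where "s \<le> a" "M' = M\<lparr>steps := steps M + s\<rparr>"
    using assms(1) M' unfolding quiet_def by (metis snd_conv)
  moreover obtain t where "t \<le> b" "snd (run_state (f x) M') = M'\<lparr>steps := steps M' + t\<rparr>"
    using assms(2) unfolding quiet_def by blast
  ultimately show "\<exists>t\<le>a + b. snd (run_state (State_Monad.bind m f) M) = M\<lparr>steps := steps M + t\<rparr>"
    using M' by (intro exI[of _ "s + t"]) (simp add: add.assoc)
qed

lemma quiet_traverse_list:
  assumes "\<And>i. quiet (f i) c"
  shows "quiet (State_Monad.traverse_list f is) (length is * c)"
proof (induction "is")
  case Nil
  show ?case by (simp add: quiet_return)
next
  case (Cons i "is")
  have "quiet (State_Monad.traverse_list f (i # is)) (c + (length is * c + 0))"
    unfolding State_Monad.traverse_list.simps by (intro quiet_bind assms Cons quiet_return)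
  then show ?case by (simp add: algebra_simps)
qed

lemma quiet_make_vec:
  assumes "\<And>i. quiet (f i) c"
  shows "quiet (make_vec n f) (n * (1 + c))"
proof -
  have "quiet (make_vec n f) (length [0..<n] * (1 + c) + 0)"
    unfolding make_vec_def by (intro quiet_bind quiet_traverse_list quiet_return quiet_tick assms)
  then show ?thesis by simp
qed

lemma quiet_make_unit_vec: "quiet (make_unit_vec n k) (2 * n)"
  unfolding make_unit_vec_def
  by (rule quiet_mono, rule quiet_make_vec, rule quiet_charge) simp

lemma quiet_column_product: "quiet (column_product R x l) (2 * dim_row R)"
proof -
  have "quiet (column_product_upto R x l m) (2 * m)" for m
  proof (induction m)
    case 0
    show ?case by (simp add: quiet_return)
  next
    case (Suc m)
    have "quiet (column_product_upto R x l (Suc m)) (2 * m + (1 + 1))"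
      unfolding column_product_upto.simps by (intro quiet_bind quiet_charge Suc)
    then show ?case by simp
  qed
  then show ?thesis by (simp add: column_product_def)
qed

lemma quiet_sub_scaled: "quiet (sub_scaled n x c y) (3 * n)"
proof -
  have "quiet (sub_scaled n x c y) (n * (1 + (1 + 1)))"
    unfolding sub_scaled_def by (intro quiet_make_vec quiet_bind quiet_charge)
  then show ?thesis by (rule quiet_mono) simp
qed

lemma quiet_shifted_reversal: "quiet (shifted_reversal n s k l x) (6 * n)"
proof -
  have "quiet (shifted_reversal n s k l x) (n * (1 + 1) + (n * (1 + 1) + n * (1 + 1)))"
    unfolding shifted_reversal_def by (intro quiet_bind quiet_make_vec quiet_charge)
  then show ?thesis by (rule quiet_mono) simp
qed

section \<open>Running time\<close>

lemma cost_mono: "cost m c \<Longrightarrow> c \<le> d \<Longrightarrow> cost m d"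
  unfolding cost_def by (meson add_left_mono order_trans)

lemma cost_quiet: "quiet m c \<Longrightarrow> cost m c"
  unfolding quiet_def cost_def
proof
  fix M assume "\<forall>M. \<exists>t\<le>c. snd (run_state m M) = M\<lparr>steps := steps M + t\<rparr>"
  then obtain t where "t \<le> c" "snd (run_state m M) = M\<lparr>steps := steps M + t\<rparr>" by blast
  then show "steps (snd (run_state m M)) \<le> steps M + c" by simp
qed

lemma cost_bind:
  assumes "cost m a" "\<And>x. cost (f x) b"
  shows "cost (State_Monad.bind m f) (a + b)"
  unfolding cost_def
proof
  fix M
  obtain x M' where M': "run_state m M = (x, M')" by fastforce
  have "steps M' \<le> steps M + a"
    using assms(1) M' unfolding cost_def by (metis snd_conv)
  moreover have "steps (snd (run_state (f x) M')) \<le> steps M' + b"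
    using assms(2) unfolding cost_def by blast
  ultimately show "steps (snd (run_state (State_Monad.bind m f) M)) \<le> steps M + (a + b)"
    using M' by simp
qed

lemma cost_store:
  assumes "\<And>g M. steps (upd g M) = steps M"
  shows "cost (store upd k l x) 1"
  using assms by (simp add: cost_def store_def tick_def State_Monad.update_def)

lemma cost_applied_update: "cost (State_Monad.update (applied_update g)) 0"
  by (simp add: cost_def State_Monad.update_def)

lemma cost_for_each:
  assumes "\<And>i. cost (body i) c"
  shows "cost (for_each is body) (length is * (1 + c))"
proof (induction "is")
  case Nil
  show ?case by (simp add: cost_quiet quiet_return)
next
  case (Cons i "is")
  have "cost (for_each (i # is) body) (1 + (c + length is * (1 + c)))"
    unfolding for_each.simps by (intro cost_bind cost_quiet[OF quiet_tick] assms Cons)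
  then show ?case by (simp add: algebra_simps)
qed

lemma cost_if: "cost m c \<Longrightarrow> cost m' d \<Longrightarrow> cost (if P then m else m') (max c d)"
  by (auto elim: cost_mono)

lemma cost_case_prod: "(\<And>x y. cost (f x y) c) \<Longrightarrow> cost (case p of (x, y) \<Rightarrow> f x y) c"
  by (cases p) simp

lemmas cost_intros =
  cost_quiet[OF quiet_return] cost_quiet[OF quiet_charge] cost_quiet[OF quiet_load]
  cost_quiet[OF quiet_make_unit_vec] cost_quiet[OF quiet_column_product]
  cost_quiet[OF quiet_sub_scaled] cost_quiet[OF quiet_shifted_reversal]
  cost_store cost_applied_update cost_if cost_case_prod cost_bind

lemma cost_subroutine1: "cost (subroutine1 R k l ph qh vh vh') (10 * dim_row R + 12)"
  unfolding subroutine1_def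
  \<comment> \<open>The bound stays schematic while the rules build it up; \<open>simp\<close> then
    compares it with the stated one. With n = \<open>dim_row R\<close>, two column products (2 n
    each) and two vector updates (3 n each) give 10 n; six scalar operations and six stores give
    12.\<close>
  by (rule cost_mono, (rule cost_intros | (simp; fail))+)

lemma cost_finish_pair: "cost (finish_pair R k k' l ph vh') (16 * dim_row R + 14)"
  unfolding finish_pair_def
  by (rule cost_mono, (rule cost_intros cost_subroutine1 | (simp; fail))+)

lemma cost_initialization: "cost (initialization n1 R) (n1 * (2 * dim_row R + 6))"
  unfolding initialization_def
  by (rule cost_mono, (rule cost_for_each cost_intros | (simp add: algebra_simps; fail))+)

text \<open>Each inner loop has at most \<open>n1\<close> rounds, so the triangle is bounded by the
  full square.\<close>

lemma cost_triangle:
  assumes "\<And>d u. cost (body d u) c" "length ds \<le> n1"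
  shows "cost (for_each ds (\<lambda>d. for_each [0..<n1 - d] (body d))) (n1 * (1 + n1 * (1 + c)))"
proof -
  have "cost (for_each [0..<n1 - d] (body d)) (n1 * (1 + c))" for d
    by (rule cost_mono[OF cost_for_each[of "body d", OF assms(1)]]) (rule mult_le_mono, simp_all)
  then have "cost (for_each ds (\<lambda>d. for_each [0..<n1 - d] (body d)))
      (length ds * (1 + n1 * (1 + c)))"
    by (rule cost_for_each)
  then show ?thesis
    by (rule cost_mono) (rule mult_le_mono, simp_all add: assms(2))
qed

text \<open>The \<open>shifted_reversal\<close> at u = 0 is charged to every round; this does not
  affect the growth rate.\<close>

lemma cost_lower_triangle_loop:
  "cost (lower_triangle_loop n1 R d2) (n1 * (1 + n1 * (22 * dim_row R + 19)))"
proof -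
  have "cost (lower_triangle_loop n1 R d2) (n1 * (1 + n1 * (1 + (22 * dim_row R + 18))))"
    unfolding lower_triangle_loop_def Let_def
    by (rule cost_triangle, rule cost_mono, (rule cost_intros cost_finish_pair | (simp; fail))+)
  then show ?thesis by (rule cost_mono) simp
qed

lemma cost_upper_triangle_loop:
  "cost (upper_triangle_loop n1 R d2) (n1 * (1 + n1 * (16 * dim_row R + 19)))"
proof -
  have "cost (upper_triangle_loop n1 R d2) (n1 * (1 + n1 * (1 + (16 * dim_row R + 18))))"
    unfolding upper_triangle_loop_def Let_def
    by (rule cost_triangle, rule cost_mono, (rule cost_intros cost_finish_pair | (simp; fail))+)
  then show ?thesis by (rule cost_mono) simp
qed

lemma cost_algorithm:
  fixes n1 n2 :: nat and R :: "complex mat"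
  defines "n \<equiv> dim_row R"
  shows "cost (algorithm n1 n2 R)
    (n1 * (2 * n + 6) + n2 * (1 + (n1 * (1 + n1 * (22 * n + 19)) + n1 * (1 + n1 * (16 * n + 19)))))"
  unfolding algorithm_def n_def
  by (rule cost_mono, (rule cost_for_each cost_initialization cost_lower_triangle_loop
        cost_upper_triangle_loop cost_intros | (simp; fail))+)

lemma steps_final_memory_le:
  assumes "1 \<le> n1" "1 \<le> n2" "R \<in> carrier_mat (n1 * n2) (n1 * n2)" "fresh M"
  shows "steps (final_memory n1 n2 R M) \<le> 87 * (n1 ^ 3 * n2 ^ 2)"
proof -
  have "steps (final_memory n1 n2 R M) \<le> n1 * (2 * (n1 * n2) + 6) +
      n2 * (1 + (n1 * (1 + n1 * (22 * (n1 * n2) + 19)) + n1 * (1 + n1 * (16 * (n1 * n2) + 19))))"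
    using cost_algorithm[of n1 n2 R] assms(3,4)
    by (auto simp: cost_def final_memory_def fresh_def dest: spec[of _ M])
  also have "\<dots> = 2 * (n1 ^ 2 * n2) + 6 * n1 + n2 + 2 * (n1 * n2) + 38 * (n1 ^ 2 * n2)
      + 38 * (n1 ^ 3 * n2 ^ 2)"
    by (simp add: algebra_simps power2_eq_square power3_eq_cube)
  also have "\<dots> \<le> 87 * (n1 ^ 3 * n2 ^ 2)"
  proof -
    \<comment> \<open>Each monomial is at most n1^3 n2^2 because \<open>n1\<close> and
      \<open>n2\<close> are positive, and 87 = 2 + 6 + 1 + 2 + 38 + 38.\<close>
    have le: "n1 ^ a * n2 ^ b \<le> n1 ^ 3 * n2 ^ 2" if "a \<le> 3" "b \<le> 2" for a b
      using that assms(1,2) by (intro mult_mono power_increasing) auto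
    show ?thesis
      using le[of 2 1] le[of 1 0] le[of 0 1] le[of 1 1] by (simp add: mult.commute)
  qed
  finally show ?thesis .
qed

section \<open>Weakest preconditions\<close>

lemma post_bind: "post (State_Monad.bind m f) M Q \<longleftrightarrow> post m M (\<lambda>x M'. post (f x) M' Q)"
  by (simp add: post_def split: prod.split)

lemma post_return: "post (State_Monad.return x) M Q \<longleftrightarrow> Q x M"
  by (simp add: post_def)

lemma post_mono: "post m M P \<Longrightarrow> (\<And>x M'. P x M' \<Longrightarrow> Q x M') \<Longrightarrow> post m M Q"
  by (simp add: post_def)

text \<open>The step count becomes arbitrary, so the correctness proof never has to track
  it.\<close>

lemma post_quiet:
  assumes "quiet m c" "\<And>M. fst (run_state m M) = x" "\<And>s. Q x (M\<lparr>steps := s\<rparr>)"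
  shows "post m M Q"
  using assms unfolding post_def quiet_def by metis

lemma post_charge: "(\<And>s. Q x (M\<lparr>steps := s\<rparr>)) \<Longrightarrow> post (charge x) M Q"
  by (simp add: post_def run_charge)

lemma post_load: "(\<And>s. Q (tab M k l) (M\<lparr>steps := s\<rparr>)) \<Longrightarrow> post (load tab k l) M Q"
  by (simp add: post_def load_def run_charge)

lemma post_store:
  "(\<And>s. Q () (upd (\<lambda>f. f(k := (f k)(l := x))) (M\<lparr>steps := s\<rparr>))) \<Longrightarrow> post (store upd k l x) M Q"
  by (simp add: post_def store_def tick_def State_Monad.update_def)

lemma post_update: "Q () (g M) \<Longrightarrow> post (State_Monad.update g) M Q"
  by (simp add: post_def State_Monad.update_def)

lemma post_tick: "post tick M Q \<longleftrightarrow> Q () (M\<lparr>steps := steps M + 1\<rparr>)"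
  by (simp add: post_def tick_def State_Monad.update_def)

text \<open>The invariant is indexed by the number of completed rounds. It must be insensitive to
  \<open>steps\<close> because every round begins with a \<open>tick\<close>.\<close>

lemma post_for_each:
  assumes "I 0 M"
    and "\<And>i M. i < length is \<Longrightarrow> I i M \<Longrightarrow> post (body (is ! i)) M (\<lambda>_. I (Suc i))"
    and "\<And>i M s. I i M \<Longrightarrow> I i (M\<lparr>steps := s\<rparr>)"
  shows "post (for_each is body) M (\<lambda>_. I (length is))"
  using assms
proof (induction "is" arbitrary: I M)
  case Nil
  then show ?case by (simp add: post_return)
next
  case (Cons i "is")
  have "post (body i) (M\<lparr>steps := s\<rparr>) (\<lambda>_ M'. post (for_each is body) M' (\<lambda>_. I (length (i # is))))" for s
  proof (rule post_mono)
    show "post (body i) (M\<lparr>steps := s\<rparr>) (\<lambda>_. I (Suc 0))"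
      using Cons.prems(2)[of 0] Cons.prems(1,3) by simp
    show "post (for_each is body) M' (\<lambda>_. I (length (i # is)))" if "I (Suc 0) M'" for M'
      using Cons.IH[of "\<lambda>j. I (Suc j)" M'] that Cons.prems(2)[of "Suc j" for j] Cons.prems(3) by simp
  qed
  then show ?case
    by (simp add: post_bind post_tick)
qed


section \<open>Correctness of the algorithm\<close>

text \<open>The coefficient tables are left out: the initialization writes none and the algorithm
  never reads them. \<open>applied_ok\<close> adds them for the treated pairs.\<close>

definition cell_ok :: "complex mat \<Rightarrow> memory \<Rightarrow> nat \<Rightarrow> nat \<Rightarrow> bool" where
  "cell_ok R M k l \<longleftrightarrow> mem_p M k l = rec_p R k l \<and> mem_q M k l = rec_q R k l \<and>
     mem_v M k l = rec_v R k l \<and> mem_v' M k l = rec_v' R k l"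

definition applied_ok :: "complex mat \<Rightarrow> memory \<Rightarrow> bool" where
  "applied_ok R M \<longleftrightarrow> (\<forall>(k, l) \<in> applied M.
     cell_ok R M k l \<and> mem_a M k l = rec_a R k l \<and> mem_a' M k l = rec_a' R k l)"

lemma steps_update_simps:
  "mem_p (M\<lparr>steps := s\<rparr>) = mem_p M" "mem_q (M\<lparr>steps := s\<rparr>) = mem_q M"
  "mem_v (M\<lparr>steps := s\<rparr>) = mem_v M" "mem_v' (M\<lparr>steps := s\<rparr>) = mem_v' M"
  "M\<lparr>steps := s, steps := t\<rparr> = M\<lparr>steps := t\<rparr>"
  by simp_all

lemma ok_steps [simp]:
  "cell_ok R (M\<lparr>steps := s\<rparr>) k l \<longleftrightarrow> cell_ok R M k l"
  "applied_ok R (M\<lparr>steps := s\<rparr>) \<longleftrightarrow> applied_ok R M"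
  by (simp_all add: cell_ok_def applied_ok_def)

text \<open>Correct cells need only stay correct, so it need not be shown that a pair is written
  only once.\<close>

definition extends_at :: "complex mat \<Rightarrow> nat \<Rightarrow> nat \<Rightarrow> memory \<Rightarrow> memory \<Rightarrow> bool" where
  "extends_at R k l M M' \<longleftrightarrow> cell_ok R M' k l \<and> (\<forall>i j. cell_ok R M i j \<longrightarrow> cell_ok R M' i j) \<and>
     (applied_ok R M \<longrightarrow> applied_ok R M')"

lemma extends_at_steps [simp]: "extends_at R k l (M\<lparr>steps := s\<rparr>) = extends_at R k l M"
  by (simp add: extends_at_def fun_eq_iff)

lemma post_subroutine1:
  assumes R: "R \<in> carrier_mat n n" "hermitian R" "positive_definite R" and kl: "k < l" "l < n"
  shows "post (subroutine1 R k l (rec_p R k (l - 1)) (rec_q R (k + 1) l) (rec_v R (k + 1) l)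
           (rec_v' R k (l - 1))) M (\<lambda>_. extends_at R k l M)"
proof -
  have dim: "dim_row R = n" using R by simp
  let ?ph = "rec_p R k (l - 1)" and ?qh = "rec_q R (k + 1) l"
  have carr: "?ph \<in> carrier_vec n" "?qh \<in> carrier_vec n"
    using rec_carrier(1)[of k "l - 1" R] rec_carrier(2)[of "k + 1" l R] kl dim by auto
  have s: "fst (run_state (column_product R ?ph l) M) = column_form R ?ph l"
    "fst (run_state (column_product R ?qh k) M) = column_form R ?qh k" for M
    using fst_column_product[OF R(1)] carr kl dim by (simp_all add: column_form_def)
  have pq: "fst (run_state (sub_scaled (dim_row R) ?ph (rec_a R k l) ?qh) M) = rec_p R k l"
    "fst (run_state (sub_scaled (dim_row R) ?qh (rec_a' R k l) ?ph) M) = rec_q R k l" for M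
    using fst_sub_scaled[OF carr] fst_sub_scaled[OF carr(2,1)] dim rec_step(1,2)[OF kl(1), of R]
    by simp_all
  show ?thesis
    unfolding subroutine1_def post_bind
    apply (rule post_quiet[OF quiet_column_product s(1)], rule post_charge)
    apply (rule post_quiet[OF quiet_column_product s(2)], rule post_charge)
    apply (unfold rec_step(3,4)[OF kl(1), of R, symmetric])
    apply (rule post_quiet[OF quiet_sub_scaled pq(1)])
    apply (rule post_quiet[OF quiet_sub_scaled pq(2)])
    apply (rule post_charge post_store post_update)+
    apply (unfold rec_v_step[OF R kl, symmetric])
    apply (auto simp: extends_at_def cell_ok_def applied_ok_def)
    done
qed

lemma reversal_index:
  assumes "x \<in> carrier_vec n" "i < n"
  shows "(subdiag n ^\<^sub>m s *\<^sub>v conjugate (tilde k l x)) $ i =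
    (if s \<le> i then cnj (if k \<le> i - s \<and> i - s \<le> l then x $ (l - (i - s) + k) else x $ (i - s)) else 0)"
proof -
  have "conjugate (tilde k l x) \<in> carrier_vec n" using assms by (simp add: tilde_def)
  then show ?thesis using assms by (simp add: subdiag_pow_mult_vec) (auto simp: tilde_def)
qed

section \<open>The two reflection shortcuts of the algorithm\<close>

context
  fixes R :: "complex mat" and n1 n2 n :: nat
  assumes R: "R \<in> carrier_mat n n" "hermitian R" "positive_definite R" and n: "n = n1 * n2"
    and tbt: "toeplitz_block_toeplitz n1 n2 R"
begin

lemma dim_R: "dim_row R = n" using R by simp

text \<open>With c = k + l the reflection carries (k, l - 1) to (k + 1, l). Reversal within k..l-1
  and a shift by one send entry k + l - i to index i, which is this reflection. The scalars are
  real, so their conjugation disappears.\<close>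

lemma rec_q_self_reflected:
  assumes "k + l + 1 = m * n1" "k < l" "l < n"
  shows "subdiag n ^\<^sub>m 1 *\<^sub>v conjugate (tilde k (l - 1) (rec_p R k (l - 1))) = rec_q R (k + 1) l"
    and "rec_v' R k (l - 1) = rec_v R (k + 1) l"
proof -
  let ?p = "rec_p R k (l - 1)" and ?q = "rec_q R (k + 1) l"
  have carr: "?p \<in> carrier_vec n" "?q \<in> carrier_vec n"
    using rec_carrier(1)[of k "l - 1" R] rec_carrier(2)[of "k + 1" l R] assms dim_R by auto
  have c: "k + l - (l - 1) = k + 1" "k + l - k = l" using assms by auto
  have refl: "?p $ i = cnj (?q $ (k + l - i))" if "k \<le> i" "i \<le> l - 1" for i
    using rec_reflection(1)[OF R(1,2) n tbt assms(1), of k "l - 1" i] that assms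
    unfolding c by simp
  show "rec_v' R k (l - 1) = rec_v R (k + 1) l"
    using rec_reflection(2)[OF R(1,2) n tbt assms(1), of k "l - 1"] assms
      rec_v_nonzero_real(3)[OF R, of "k + 1" l] unfolding c by simp
  show "subdiag n ^\<^sub>m 1 *\<^sub>v conjugate (tilde k (l - 1) ?p) = ?q"
  proof (rule eq_vecI)
    fix i assume "i < dim_vec ?q"
    then have i: "i < n" using carr by simp
    \<comment> \<open>Outside k+1..l both sides vanish by support.\<close>
    consider "i \<le> k" | "k < i" "i \<le> l" | "l < i" by linarith
    then show "(subdiag n ^\<^sub>m 1 *\<^sub>v conjugate (tilde k (l - 1) ?p)) $ i = ?q $ i"
    proof cases
      case 2
      then have "l - 1 - (i - 1) + k = k + l - i" "k \<le> k + l - i" "k + l - i \<le> l - 1"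
        "k + l - (k + l - i) = i"
        using assms by auto
      then show ?thesis
        using 2 refl[of "k + l - i"] assms by (subst reversal_index[OF carr(1) i]) auto
    qed ((subst reversal_index[OF carr(1) i], use assms dim_R i in \<open>auto simp: rec_support\<close>)[1])+
  qed (use carr in \<open>simp add: subdiag_def\<close>)
qed

text \<open>The reflection carries (k, c) to (0, c - k). It is used with c = l - 1 when l starts a
  new block: the last index of a block passes the test of the loops only for k = 0, so for other k <
  n1 the vector at (k, l - 1) has not been computed.\<close>

lemma rec_p_reflected:
  assumes "c + 1 = m * n1" "k \<le> c" "c < n"
  shows "subdiag n ^\<^sub>m k *\<^sub>v conjugate (tilde 0 (c - k) (rec_q R 0 (c - k))) = rec_p R k c"
    and "rec_v' R k c = rec_v R 0 (c - k)"
proof -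
  let ?p = "rec_p R k c" and ?q = "rec_q R 0 (c - k)"
  have carr: "?p \<in> carrier_vec n" "?q \<in> carrier_vec n"
    using rec_carrier(1)[of k c R] rec_carrier(2)[of 0 "c - k" R] assms dim_R by auto
  have refl: "?p $ i = cnj (?q $ (c - i))" if "k \<le> i" "i \<le> c" for i
    using rec_reflection(1)[OF R(1,2) n tbt assms(1), of k c i] that assms by simp
  show "rec_v' R k c = rec_v R 0 (c - k)"
    using rec_reflection(2)[OF R(1,2) n tbt assms(1), of k c] assms
      rec_v_nonzero_real(3)[OF R, of 0 "c - k"] by simp
  show "subdiag n ^\<^sub>m k *\<^sub>v conjugate (tilde 0 (c - k) ?q) = ?p"
  proof (rule eq_vecI)
    fix i assume "i < dim_vec ?p"
    then have i: "i < n" using carr by simp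
    consider "i < k" | "k \<le> i" "i \<le> c" | "c < i" by linarith
    then show "(subdiag n ^\<^sub>m k *\<^sub>v conjugate (tilde 0 (c - k) ?q)) $ i = ?p $ i"
    proof cases
      case 2
      then have "c - k - (i - k) = c - i" by auto
      then show ?thesis
        using 2 refl[of i] by (subst reversal_index[OF carr(2) i]) auto
    qed ((subst reversal_index[OF carr(2) i], use assms dim_R i in \<open>auto simp: rec_support\<close>)[1])+
  qed (use carr in \<open>simp add: subdiag_pow\<close>)
qed

text \<open>If k + l1 = n1 - 1, then k + l + 1 is a multiple of \<open>n1\<close> and
  \<open>rec_q_self_reflected\<close> applies. Otherwise (k + 1, l) also passes the test, and
  \<open>ok\<close> provides its cell.\<close>

lemma post_finish_pair:
  assumes l: "l = l2 * n1 + l1" "l1 < n1" "k + l1 < n1" and kl: "k < l" "l < n"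
    and ok: "k + l1 + 1 < n1 \<Longrightarrow> cell_ok R M (k + 1) l"
  shows "post (finish_pair R k (k sec n1 + n1 - 1 - l mod n1) l (rec_p R k (l - 1)) (rec_v' R k (l - 1)))
    M (\<lambda>_. extends_at R k l M)"
proof -
  have k': "k sec n1 + n1 - 1 - l mod n1 = n1 - 1 - l1"
    using l by (simp add: sec_op_def)
  have sub: "post (subroutine1 R k l (rec_p R k (l - 1)) (rec_q R (k + 1) l) (rec_v R (k + 1) l)
           (rec_v' R k (l - 1))) (M\<lparr>steps := s\<rparr>) (\<lambda>_. extends_at R k l M)" for s
    using post_subroutine1[OF R kl, of "M\<lparr>steps := s\<rparr>"] by simp
  show ?thesis
  proof (cases "k = n1 - 1 - l1")
    case True
    then have m: "k + l + 1 = (l2 + 1) * n1" using l by simp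
    note refl = rec_q_self_reflected[OF m kl]
    have carr: "rec_p R k (l - 1) \<in> carrier_vec n"
      using rec_carrier(1)[of k "l - 1" R] kl dim_R by auto
    have y: "fst (run_state (shifted_reversal (dim_row R) 1 k (l - 1) (rec_p R k (l - 1))) M) =
        rec_q R (k + 1) l" for M
      using fst_shifted_reversal[OF carr] refl(1) dim_R by simp
    show ?thesis
      unfolding finish_pair_def k' if_P[OF True] post_bind
      apply (rule post_quiet[OF quiet_shifted_reversal y])
      apply (unfold post_return prod.case)
      \<comment> \<open>This branch passes \<open>vh'\<close> for both scalars, so the two values
        have to be identified.\<close>
      apply (rule sub[folded refl(2)])
      done
  next
    case False
    then have "cell_ok R M (k + 1) l" using ok l by simp
    then have q: "mem_q M (k + 1) l = rec_q R (k + 1) l" "mem_v M (k + 1) l = rec_v R (k + 1) l"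
      by (simp_all add: cell_ok_def)
    show ?thesis
      unfolding finish_pair_def k' if_not_P[OF False] post_bind
      apply (rule post_load)+
      apply (unfold post_return prod.case)
      apply (use sub q in simp)
      done
  qed
qed

text \<open>Writing \<open>l = l2 * n1 + l1\<close>, the test \<open>k \<le> k'\<close> of the loops reads \<open>k + l1 < n1\<close>.
  The predicate \<open>P\<close> describes the pairs that have been treated so far.\<close>

definition ready :: "(nat \<Rightarrow> nat \<Rightarrow> nat \<Rightarrow> bool) \<Rightarrow> memory \<Rightarrow> bool" where
  "ready P M \<longleftrightarrow> applied_ok R M \<and>
     (\<forall>k l2 l1. l2 < n2 \<and> k + l1 < n1 \<and> k \<le> l2 * n1 + l1 \<and> P k l2 l1 \<longrightarrow> cell_ok R M k (l2 * n1 + l1))"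

lemma ready_steps: "ready P M \<Longrightarrow> ready P (M\<lparr>steps := s\<rparr>)"
  by (simp add: ready_def)

lemma readyD:
  "ready P M \<Longrightarrow> l2 < n2 \<Longrightarrow> k + l1 < n1 \<Longrightarrow> k \<le> l2 * n1 + l1 \<Longrightarrow> P k l2 l1 \<Longrightarrow>
    cell_ok R M k (l2 * n1 + l1)"
  by (simp add: ready_def)

lemma ready_cong:
  assumes "ready P M"
    and "\<And>k l2 l1. l2 < n2 \<Longrightarrow> k + l1 < n1 \<Longrightarrow> k \<le> l2 * n1 + l1 \<Longrightarrow> Q k l2 l1 \<Longrightarrow> P k l2 l1"
  shows "ready Q M"
  using assms by (simp add: ready_def)

lemma ready_extends_at:
  assumes "ready P M" "extends_at R k (l2 * n1 + l1) M M'"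
    and "\<And>i j2 j1. j2 < n2 \<Longrightarrow> i + j1 < n1 \<Longrightarrow> Q i j2 j1 \<Longrightarrow> P i j2 j1 \<or> (i = k \<and> j2 = l2 \<and> j1 = l1)"
  shows "ready Q M'"
  using assms unfolding ready_def extends_at_def by blast

lemma index_less: "l2 < n2 \<Longrightarrow> l1 < n1 \<Longrightarrow> l2 * n1 + l1 < n"
proof -
  assume "l2 < n2" "l1 < n1"
  then have "l2 * n1 + l1 < (l2 + 1) * n1" by simp
  also have "\<dots> \<le> n2 * n1" using \<open>l2 < n2\<close> by (intro mult_le_mono1) simp
  finally show ?thesis by (simp add: n mult.commute)
qed

section \<open>Initialization and loop invariants\<close>

lemma post_initialization:
  assumes "applied M = {}" "1 \<le> n2"
  shows "post (initialization n1 R) M (\<lambda>_. ready (\<lambda>k l2 l1. l2 = 0 \<and> k = l1))"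
proof -
  \<comment> \<open>As \<open>applied\<close> stays empty, \<open>applied_ok\<close> holds vacuously
    at the end.\<close>
  let ?I = "\<lambda>i M. applied M = {} \<and> (\<forall>k<i. cell_ok R M k k)"
  have "post (initialization n1 R) M (\<lambda>_. ?I (length [0..<n1]))"
    unfolding initialization_def
  proof (rule post_for_each)
    fix i M assume i: "i < length [0..<n1]" and I: "?I i M"
    have e: "fst (run_state (make_unit_vec (dim_row R) ([0..<n1] ! i)) M) = unit_vec n i" for M
      using i fst_make_vec[of "\<lambda>j. charge (if j = i then 1 else 0)" "\<lambda>j. if j = i then 1 else 0" n M]
      by (auto simp: make_unit_vec_def dim_R unit_vec_def run_charge)
    have "i < n" using i index_less[of 0 i] assms(2) by simp
    then have "column_form R (unit_vec n i) i = R $$ (0, 0)"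
      using R toeplitz_block_toeplitz_diag[OF tbt, of i] n
      by (simp add: column_form_def)
    then have v: "rec_v R i i = R $$ (0, 0)" "rec_v' R i i = R $$ (0, 0)"
      by (simp_all add: rec_v_column_form rec_diag dim_R)
    have nth: "[0..<n1] ! i = i" using i by simp
    show "post (do {
         e \<leftarrow> make_unit_vec (dim_row R) ([0..<n1] ! i);
         store mem_p_update ([0..<n1] ! i) ([0..<n1] ! i) e;
         store mem_q_update ([0..<n1] ! i) ([0..<n1] ! i) e;
         r \<leftarrow> charge (R $$ (0, 0));
         store mem_v_update ([0..<n1] ! i) ([0..<n1] ! i) r;
         store mem_v'_update ([0..<n1] ! i) ([0..<n1] ! i) r
       }) M (\<lambda>_. ?I (Suc i))"
      unfolding post_bind
      apply (rule post_quiet[OF quiet_make_unit_vec e])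
      apply (rule post_store post_charge)+
      apply (use I in \<open>auto simp: nth cell_ok_def less_Suc_eq v rec_diag dim_R\<close>)
      done
  qed (use assms in auto)
  then show ?thesis
    by (rule post_mono) (auto simp: ready_def applied_ok_def)
qed

text \<open>\<open>P\<close> and \<open>Q\<close> describe the treated pairs before and after;
  \<open>Q\<close> may exceed \<open>P\<close> only by the pair just processed.\<close>

lemma post_pair:
  assumes I: "ready P M" and l2: "l2 < n2" and k: "k + l1 < n1" "k < l2 * n1 + l1"
    and ph: "ph = rec_p R k (l2 * n1 + l1 - 1)" and vh': "vh' = rec_v' R k (l2 * n1 + l1 - 1)"
    and P: "k + 1 + l1 < n1 \<Longrightarrow> P (k + 1) l2 l1"
    and Q: "\<And>i j2 j1. j2 < n2 \<Longrightarrow> i + j1 < n1 \<Longrightarrow> Q i j2 j1 \<Longrightarrow> P i j2 j1 \<or> (i = k \<and> j2 = l2 \<and> j1 = l1)"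
  shows "post (finish_pair R k (k sec n1 + n1 - 1 - (l2 * n1 + l1) mod n1) (l2 * n1 + l1) ph vh')
    (M\<lparr>steps := s\<rparr>) (\<lambda>_. ready Q)"
  unfolding ph vh'
proof (rule post_mono)
  have "l2 * n1 + l1 < n" using index_less l2 k by simp
  moreover have "cell_ok R M (k + 1) (l2 * n1 + l1)" if "k + l1 + 1 < n1"
    using readyD[OF I l2, of "k + 1" l1] that k P by auto
  ultimately show "post (finish_pair R k (k sec n1 + n1 - 1 - (l2 * n1 + l1) mod n1) (l2 * n1 + l1)
      (rec_p R k (l2 * n1 + l1 - 1)) (rec_v' R k (l2 * n1 + l1 - 1))) (M\<lparr>steps := s\<rparr>)
      (\<lambda>_. extends_at R k (l2 * n1 + l1) (M\<lparr>steps := s\<rparr>))"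
    using k by (intro post_finish_pair[OF refl]) auto
  show "ready Q M'" if "extends_at R k (l2 * n1 + l1) (M\<lparr>steps := s\<rparr>) M'" for M'
    using I that[simplified] by (rule ready_extends_at) (rule Q)
qed

text \<open>In \<open>I i u\<close>, i counts the finished diagonals and u the finished pairs of the
  current one; a full diagonal rolls over to (i + 1, 0).\<close>

lemma post_triangle:
  assumes "I 0 0 M"
    and "\<And>i u M. i < length ds \<Longrightarrow> u + ds ! i < n1 \<Longrightarrow> I i u M \<Longrightarrow>
      post (body (ds ! i) u) M (\<lambda>_. I i (Suc u))"
    and "\<And>i M. i < length ds \<Longrightarrow> I i (n1 - ds ! i) M \<Longrightarrow> I (Suc i) 0 M"
    and steps: "\<And>i u M s. I i u M \<Longrightarrow> I i u (M\<lparr>steps := s\<rparr>)"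
  shows "post (for_each ds (\<lambda>d. for_each [0..<n1 - d] (body d))) M (\<lambda>_. I (length ds) 0)"
proof (rule post_for_each)
  fix i M assume i: "i < length ds" and "I i 0 M"
  then have "post (for_each [0..<n1 - ds ! i] (body (ds ! i))) M
      (\<lambda>_. I i (length [0..<n1 - ds ! i]))"
    using assms(2) by (intro post_for_each steps) auto
  then show "post (for_each [0..<n1 - ds ! i] (body (ds ! i))) M (\<lambda>_. I (Suc i) 0)"
    by (rule post_mono) (use assms(3) i in simp)
qed (use assms(1) steps in auto)

lemma post_upper_triangle_loop:
  assumes d2: "d2 < n2" and init: "ready (\<lambda>k l2 l1. l2 < d2 \<or> l2 = d2 \<and> l1 \<le> k) M"
  shows "post (upper_triangle_loop n1 R d2) M (\<lambda>_. ready (\<lambda>k l2 l1. l2 < d2 + 1))"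
proof -
  \<comment> \<open>Round i has d1 = i + 1 and treats the diagonal l1 - k = i + 1 by increasing k.
    Initially all l1 \<le> k are done; after the last round the bound is l1 < k + n1, which always
    holds.\<close>
  let ?J = "\<lambda>i u k l2 l1. l2 < d2 \<or> l2 = d2 \<and> (l1 < k + (i + 1) \<or> l1 = k + (i + 1) \<and> k < u)"
  have "post (upper_triangle_loop n1 R d2) M (\<lambda>_. ready (?J (length [1..<n1]) 0))"
    unfolding upper_triangle_loop_def
  proof (rule post_triangle[where I = "\<lambda>i u. ready (?J i u)"])
    show "ready (?J 0 0) M"
      using init by (rule ready_cong) auto
  next
    fix i u M assume i: "i < length [1..<n1]" and u: "u + [1..<n1] ! i < n1" and I: "ready (?J i u) M"
    define l1 where "l1 = u + [1..<n1] ! i"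
    have l1: "l1 = u + (i + 1)" "l1 < n1" using i u by (simp_all add: l1_def)
    show "post (let k = u; l = d2 * n1 + u + [1..<n1] ! i; k' = k sec n1 + n1 - 1 - (l mod n1) in
       if k \<le> k' then do {
         ph \<leftarrow> load mem_p k (l - 1);
         vh' \<leftarrow> load mem_v' k (l - 1);
         finish_pair R k k' l ph vh'
       } else State_Monad.return ()) M (\<lambda>_. ready (?J i (Suc u)))"
      unfolding Let_def add.assoc[of _ u] l1_def[symmetric]
    proof (split if_split, intro conjI impI)
      assume "u \<le> u sec n1 + n1 - 1 - (d2 * n1 + l1) mod n1"
      then have c: "u + l1 < n1" using l1 by (simp add: sec_op_def)
      \<comment> \<open>The predecessors (k, l1 - 1) and (k + 1, l1) lie on the preceding
        diagonal.\<close>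
      have "cell_ok R M u (d2 * n1 + (l1 - 1))"
        using readyD[OF I d2, of u "l1 - 1"] c l1 by auto
      then have cell: "mem_p M u (d2 * n1 + l1 - 1) = rec_p R u (d2 * n1 + l1 - 1)"
        "mem_v' M u (d2 * n1 + l1 - 1) = rec_v' R u (d2 * n1 + l1 - 1)"
        using l1 by (simp_all add: cell_ok_def)
      have finish: "post (finish_pair R u (u sec n1 + n1 - 1 - (d2 * n1 + l1) mod n1) (d2 * n1 + l1)
          (rec_p R u (d2 * n1 + l1 - 1)) (rec_v' R u (d2 * n1 + l1 - 1))) (M\<lparr>steps := s\<rparr>)
          (\<lambda>_. ready (?J i (Suc u)))" for s
        by (rule post_pair[OF I d2]) (use c l1 in auto)
      show "post (do {
         ph \<leftarrow> load mem_p u (d2 * n1 + l1 - 1);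
         vh' \<leftarrow> load mem_v' u (d2 * n1 + l1 - 1);
         finish_pair R u (u sec n1 + n1 - 1 - (d2 * n1 + l1) mod n1) (d2 * n1 + l1) ph vh'
       }) M (\<lambda>_. ready (?J i (Suc u)))"
        unfolding post_bind
        apply (rule post_load)+
        apply (unfold steps_update_simps cell)
        apply (rule finish)
        done
    next
      assume "\<not> u \<le> u sec n1 + n1 - 1 - (d2 * n1 + l1) mod n1"
      then have "\<not> u + l1 < n1" using l1 by (simp add: sec_op_def)
      \<comment> \<open>Pairs that fail the test are excluded by \<open>ready\<close>, so the
        invariant advances without a write.\<close>
      then show "post (State_Monad.return ()) M (\<lambda>_. ready (?J i (Suc u)))"
        unfolding post_return using I l1 by (elim ready_cong) (auto simp: less_Suc_eq)
    qed
  next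
    fix i M assume "i < length [1..<n1]" and "ready (?J i (n1 - [1..<n1] ! i)) M"
    then show "ready (?J (Suc i) 0) M"
      by (elim ready_cong) auto
  qed (rule ready_steps)
  then show ?thesis
    by (rule post_mono, elim ready_cong) auto
qed

lemma post_lower_triangle_loop:
  assumes d2: "d2 < n2" "d2 \<noteq> 0" and init: "ready (\<lambda>k l2 l1. l2 < d2) M"
  shows "post (lower_triangle_loop n1 R d2) M (\<lambda>_. ready (\<lambda>k l2 l1. l2 < d2 \<or> l2 = d2 \<and> l1 \<le> k))"
proof -
  \<comment> \<open>Here d1 = n1 - 1 - i, so the diagonals l1 - k = i + 1 - n1 run from the corner
    to the main diagonal; sums avoid truncated subtraction. After n1 rounds the condition reads l1
    \<le> k.\<close>
  let ?J = "\<lambda>i u k l2 l1. l2 < d2 \<or>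
    l2 = d2 \<and> (l1 + n1 < k + (i + 1) \<or> l1 + n1 = k + (i + 1) \<and> l1 < u)"
  have "post (lower_triangle_loop n1 R d2) M (\<lambda>_. ready (?J (length (rev [0..<n1])) 0))"
    unfolding lower_triangle_loop_def
  proof (rule post_triangle[where I = "\<lambda>i u. ready (?J i u)"])
    show "ready (?J 0 0) M"
      using init by (rule ready_cong) auto
  next
    fix i u M assume i: "i < length (rev [0..<n1])" and u: "u + rev [0..<n1] ! i < n1"
      and I: "ready (?J i u) M"
    define k where "k = u + rev [0..<n1] ! i"
    have k: "k + (i + 1) = u + n1" "k < n1" using i u by (auto simp: k_def rev_nth)
    \<comment> \<open>Since \<open>d2\<close> is not 0, l is at least \<open>n1\<close> and so
      exceeds k.\<close>
    have n1: "n1 \<le> d2 * n1" using d2 by simp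
    let ?l = "d2 * n1 + u" and ?k' = "k sec n1 + n1 - 1 - (d2 * n1 + u) mod n1"
    have k': "k \<le> ?k' \<longleftrightarrow> k + u < n1" using i u k by (auto simp: sec_op_def)
    show "post (let k = u + rev [0..<n1] ! i; l = ?l; k' = k sec n1 + n1 - 1 - (l mod n1) in
       if k \<le> k' then do {
         (ph, vh') \<leftarrow>
           (if u = 0 then
              let (k0, l0) = otimes n1 k (l - 1) in do {
                x \<leftarrow> load mem_q k0 l0;
                y \<leftarrow> shifted_reversal (dim_row R) k k0 l0 x;
                w \<leftarrow> load mem_v k0 l0;
                State_Monad.return (y, w)
              }
            else do {
              y \<leftarrow> load mem_p k (l - 1);
              w \<leftarrow> load mem_v' k (l - 1);
              State_Monad.return (y, w)
            });
         finish_pair R k k' l ph vh'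
       } else State_Monad.return ()) M (\<lambda>_. ready (?J i (Suc u)))"
      unfolding Let_def k_def[symmetric]
    proof (split if_split, intro conjI impI)
      assume "k \<le> ?k'"
      then have c: "k + u < n1" using k' by blast
      have kl: "k < ?l" using k n1 by linarith
      have finish: "post (finish_pair R k ?k' ?l (rec_p R k (?l - 1)) (rec_v' R k (?l - 1)))
          (M\<lparr>steps := s\<rparr>) (\<lambda>_. ready (?J i (Suc u)))" for s
        by (rule post_pair[OF I d2(1)]) (use c k kl in auto)
      show "post (do {
         (ph, vh') \<leftarrow>
           (if u = 0 then
              case otimes n1 k (?l - 1) of (k0, l0) \<Rightarrow> do {
                x \<leftarrow> load mem_q k0 l0;
                y \<leftarrow> shifted_reversal (dim_row R) k k0 l0 x;
                w \<leftarrow> load mem_v k0 l0;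
                State_Monad.return (y, w)
              }
            else do {
              y \<leftarrow> load mem_p k (?l - 1);
              w \<leftarrow> load mem_v' k (?l - 1);
              State_Monad.return (y, w)
            });
         finish_pair R k ?k' ?l ph vh'
       }) M (\<lambda>_. ready (?J i (Suc u)))"
      proof (cases "u = 0")
        case True
        obtain e where e: "d2 = Suc e" using d2 by (cases d2) auto
        let ?c = "d2 * n1 - 1"
        have c_less: "?c < n" using index_less[OF d2(1), of 0] c by simp
        have l: "?l - 1 = ?c" using True by simp
        \<comment> \<open>With r for n1 - 1, the form c = r + e n1 shows quotient and remainder of c
          without truncated subtraction.\<close>
        define r where "r = n1 - 1"
        have r: "n1 = r + 1" "k \<le> r" using k by (simp_all add: r_def)
        have ce: "?c = r + e * n1" using c e by (simp add: r_def)
        have "r < n1" using r(1) by simp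
        then have dm: "?c mod n1 = r" "?c div n1 = e" unfolding ce by simp_all
        have "n1 * e + n1 - 1 = ?c" unfolding ce using r(1) by (simp add: mult.commute)
        then have ot: "otimes n1 k (?l - 1) = (0, ?c - k)"
          unfolding l otimes_def sec_op_def dm using k r_def by simp
        \<comment> \<open>The index c - k = e n1 + (r - k) lies in the preceding block, and (0, c -
          k) passes the test since r - k < n1.\<close>
        have "cell_ok R M 0 (e * n1 + (r - k))"
          using readyD[OF I, of e 0 "r - k"] e d2 r by auto
        then have cell: "mem_q M 0 (?c - k) = rec_q R 0 (?c - k)" "mem_v M 0 (?c - k) = rec_v R 0 (?c - k)"
          unfolding ce using r by (simp_all add: cell_ok_def add.commute)
        have m: "?c + 1 = d2 * n1" "k \<le> ?c" using k(2) n1 by linarith+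
        note refl = rec_p_reflected[OF m c_less]
        have "rec_q R 0 (?c - k) \<in> carrier_vec n"
          using rec_carrier(2)[of 0 "?c - k" R] dim_R by simp
        then have y: "fst (run_state (shifted_reversal (dim_row R) k 0 (?c - k) (rec_q R 0 (?c - k))) M)
            = rec_p R k ?c" for M
          using fst_shifted_reversal refl(1) dim_R by simp
        show ?thesis
          unfolding if_P[OF True] ot prod.case post_bind
          apply (rule post_load)
          apply (unfold steps_update_simps cell)
          apply (rule post_quiet[OF quiet_shifted_reversal y])
          apply (rule post_load)
          apply (unfold post_return prod.case steps_update_simps cell refl(2)[symmetric])
          apply (rule finish[unfolded l])
          done
      next
        case False
        have "k \<le> d2 * n1 + (u - 1)" using k(2) n1 by linarith
        then have "cell_ok R M k (d2 * n1 + (u - 1))"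
          using readyD[OF I d2(1), of k "u - 1"] c k False by auto
        then have cell: "mem_p M k (?l - 1) = rec_p R k (?l - 1)" "mem_v' M k (?l - 1) = rec_v' R k (?l - 1)"
          using False by (simp_all add: cell_ok_def)
        show ?thesis
          unfolding if_not_P[OF False] post_bind
          apply (rule post_load)+
          apply (unfold post_return prod.case steps_update_simps cell)
          apply (rule finish)
          done
      qed
    next
      assume "\<not> k \<le> ?k'"
      then have "\<not> k + u < n1" using k' by blast
      then show "post (State_Monad.return ()) M (\<lambda>_. ready (?J i (Suc u)))"
        unfolding post_return using I k by (elim ready_cong) (auto simp: less_Suc_eq)
    qed
  next
    fix i M assume "i < length (rev [0..<n1])" and "ready (?J i (n1 - rev [0..<n1] ! i)) M"
    then show "ready (?J (Suc i) 0) M"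
      by (elim ready_cong) (auto simp: rev_nth)
  qed (rule ready_steps)
  then show ?thesis
    by (rule post_mono, elim ready_cong) auto
qed

lemma post_algorithm:
  assumes "applied M = {}" "1 \<le> n2"
  shows "post (algorithm n1 n2 R) M (\<lambda>_. applied_ok R)"
proof -
  \<comment> \<open>The second disjunct records the diagonal written by the initialization before
    the first round.\<close>
  let ?I = "\<lambda>d2. ready (\<lambda>k l2 l1. l2 < d2 \<or> d2 = 0 \<and> l2 = 0 \<and> k = l1)"
  have body: "post (do {
       (if d2 \<noteq> 0 then lower_triangle_loop n1 R d2 else State_Monad.return ());
       upper_triangle_loop n1 R d2
     }) M (\<lambda>_. ?I (Suc d2))" if d2: "d2 < n2" and I: "?I d2 M" for d2 M
    unfolding post_bind
  proof (rule post_mono)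
    show "post (if d2 \<noteq> 0 then lower_triangle_loop n1 R d2 else State_Monad.return ()) M
        (\<lambda>_. ready (\<lambda>k l2 l1. l2 < d2 \<or> l2 = d2 \<and> l1 \<le> k))"
    proof (cases "d2 = 0")
      case True
      \<comment> \<open>In the first block \<open>ready\<close> concerns only k \<le> l1, so l1
        \<le> k leaves exactly the diagonal.\<close>
      then show ?thesis using I by (auto simp: post_return elim!: ready_cong)
    next
      case False
      then show ?thesis using post_lower_triangle_loop[OF d2] I by simp
    qed
    show "post (upper_triangle_loop n1 R d2) M' (\<lambda>_. ?I (Suc d2))"
      if "ready (\<lambda>k l2 l1. l2 < d2 \<or> l2 = d2 \<and> l1 \<le> k) M'" for M'
      using post_upper_triangle_loop[OF d2 that] by simp
  qed
  show ?thesis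
    unfolding algorithm_def post_bind
  proof (rule post_mono[OF post_initialization[OF assms]])
    fix M' assume "ready (\<lambda>k l2 l1. l2 = 0 \<and> k = l1) M'"
    then have "?I 0 M'" by simp
    then have "post (for_each [0..<n2] (\<lambda>d2. do {
       (if d2 \<noteq> 0 then lower_triangle_loop n1 R d2 else State_Monad.return ());
       upper_triangle_loop n1 R d2
     })) M' (\<lambda>_. ?I (length [0..<n2]))"
    proof (rule post_for_each)
      fix i M assume "i < length [0..<n2]" and I: "?I i M"
      then have nth: "[0..<n2] ! i = i" and i: "i < n2" by auto
      show "post (do {
         (if [0..<n2] ! i \<noteq> 0 then lower_triangle_loop n1 R ([0..<n2] ! i) else State_Monad.return ());
         upper_triangle_loop n1 R ([0..<n2] ! i)
       }) M (\<lambda>_. ?I (Suc i))"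
        unfolding nth using i I by (rule body)
    qed (rule ready_steps)
    then show "post (for_each [0..<n2] (\<lambda>d2. do {
       (if d2 \<noteq> 0 then lower_triangle_loop n1 R d2 else State_Monad.return ());
       upper_triangle_loop n1 R d2
     })) M' (\<lambda>_. applied_ok R)"
      by (rule post_mono) (simp add: ready_def)
  qed
qed

end

theorem theorem2:
  "(\<forall>(n1::nat) (n2::nat) (R::complex mat) M.
      1 \<le> n1 \<and> 1 \<le> n2 \<and> R \<in> carrier_mat (n1 * n2) (n1 * n2) \<and>
      hermitian R \<and> positive_definite R \<and> toeplitz_block_toeplitz n1 n2 R \<and> fresh M \<longrightarrow>
      (\<forall>(k, l) \<in> applied (final_memory n1 n2 R M).
         mem_p (final_memory n1 n2 R M) k l = rec_p R k l \<and>
         mem_q (final_memory n1 n2 R M) k l = rec_q R k l \<and>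
         mem_a (final_memory n1 n2 R M) k l = rec_a R k l \<and>
         mem_a' (final_memory n1 n2 R M) k l = rec_a' R k l \<and>
         mem_v (final_memory n1 n2 R M) k l = rec_v R k l \<and>
         mem_v' (final_memory n1 n2 R M) k l = rec_v' R k l)) \<and>
   (\<exists>C::real. \<forall>(n1::nat) (n2::nat) (R::complex mat) M.
      1 \<le> n1 \<and> 1 \<le> n2 \<and> R \<in> carrier_mat (n1 * n2) (n1 * n2) \<and>
      hermitian R \<and> positive_definite R \<and> toeplitz_block_toeplitz n1 n2 R \<and> fresh M \<longrightarrow>
      real (steps (final_memory n1 n2 R M)) \<le> C * real n1 ^ 3 * real n2 ^ 2)"
proof (intro conjI exI[of _ 87] allI impI)
  fix n1 n2 :: nat and R :: "complex mat" and M
  assume asm: "1 \<le> n1 \<and> 1 \<le> n2 \<and> R \<in> carrier_mat (n1 * n2) (n1 * n2) \<and>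
      hermitian R \<and> positive_definite R \<and> toeplitz_block_toeplitz n1 n2 R \<and> fresh M"
  then have "applied_ok R (final_memory n1 n2 R M)"
    using post_algorithm[OF _ _ _ refl, of R n1 n2 M]
    by (simp add: post_def final_memory_def fresh_def)
  then show "\<forall>(k, l) \<in> applied (final_memory n1 n2 R M).
         mem_p (final_memory n1 n2 R M) k l = rec_p R k l \<and>
         mem_q (final_memory n1 n2 R M) k l = rec_q R k l \<and>
         mem_a (final_memory n1 n2 R M) k l = rec_a R k l \<and>
         mem_a' (final_memory n1 n2 R M) k l = rec_a' R k l \<and>
         mem_v (final_memory n1 n2 R M) k l = rec_v R k l \<and>
         mem_v' (final_memory n1 n2 R M) k l = rec_v' R k l"
    by (auto simp: applied_ok_def cell_ok_def)
  have "real (steps (final_memory n1 n2 R M)) \<le> real (87 * (n1 ^ 3 * n2 ^ 2))"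
    using steps_final_memory_le[of n1 n2 R M] asm by (intro of_nat_mono) auto
  then show "real (steps (final_memory n1 n2 R M)) \<le> 87 * real n1 ^ 3 * real n2 ^ 2"
    by simp
qed

end
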